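(* For an integer $n\geq 3$, let $F_{2,n}$ be the graph obtained from the $4$-cycle $C_4$ by adding $n-2$ pendant edges at a single vertex of $C_4$. Then: (1) for all integers $k\geq 1$ and $n\in\{3,4\}$, $gr_k(K_3 : F_{2,n})=r_2(F_{2,n})+k-2$; (2) for every integer $k\geq 3$, $gr_k(K_3 : F_{2,5})=k+9$; (3) for all integers $k\geq 3$ and $n\geq 6$, $$k(n-1)+2\ \geq\ gr_k(K_3 : F_{2,n})\ \geq\ \begin{cases} \frac{5n}{2}+k-6, & \text{if } n \text{ is even},\\ \frac{5n-1}{2}+k-4, & \text{if } n \text{ is odd}.\end{cases}$$
   Context: A $k$-coloring of a graph is an assignment of one of $k$ colors to each edge (not necessarily proper). A subgraph is monochromatic if all its edges have the same color and rainbow if all its edges have distinct colors. For graphs $G$ and $H$, the $k$-colored Gallai-Ramsey number $gr_k(G : H)$ is the minimum integer $N$ such that every $k$-coloring of the edges of $K_N$ contains either a rainbow copy of $G$ or a monochromatic copy of $H$ (copies are subgraphs, not necessarily induced). The Ramsey number $r_2(H)$ is the minimum $N$ such that every $2$-coloring of the edges of $K_N$ contains a monochromatic copy of $H$. Here $K_3$ is the triangle. *)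

theory Defs
  imports Complex_Main "HOL-Library.Ramsey"
begin

text \<open>A graph is a pair of a vertex set and a set of two-element subsets of it. All graphs
  occurring below are finite and simple.\<close>

type_synonym 'a graph = "'a set \<times> 'a set set"

abbreviation verts :: "'a graph \<Rightarrow> 'a set" where "verts \<equiv> fst"
abbreviation edges :: "'a graph \<Rightarrow> 'a set set" where "edges \<equiv> snd"

definition is_graph :: "'a graph \<Rightarrow> bool" where
  "is_graph G \<longleftrightarrow> finite (verts G) \<and> edges G \<subseteq> nsets (verts G) 2"

definition complete_graph :: "nat \<Rightarrow> nat graph" where
  "complete_graph N = ({..<N}, nsets {..<N} 2)"

definition subgraph :: "'a graph \<Rightarrow> 'a graph \<Rightarrow> bool" where
  "subgraph S G \<longleftrightarrow> is_graph S \<and> verts S \<subseteq> verts G \<and> edges S \<subseteq> edges G"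

definition isomorphic :: "'a graph \<Rightarrow> 'b graph \<Rightarrow> bool" where
  "isomorphic G H \<longleftrightarrow>
     (\<exists>f. bij_betw f (verts G) (verts H) \<and> edges H = (\<lambda>e. f ` e) ` edges G)"

text \<open>\<open>S\<close> is a (not necessarily induced) copy of \<open>H\<close> in \<open>G\<close>.\<close>

definition copy_in :: "'a graph \<Rightarrow> 'b graph \<Rightarrow> 'a graph \<Rightarrow> bool" where
  "copy_in S H G \<longleftrightarrow> subgraph S G \<and> isomorphic H S"

text \<open>The colors are \<open>0, \<dots>, k - 1\<close>; a coloring need not use all of them. Its values outside the
  edge set are irrelevant.\<close>

definition edge_coloring :: "nat \<Rightarrow> 'a graph \<Rightarrow> ('a set \<Rightarrow> nat) \<Rightarrow> bool" where
  "edge_coloring k G c \<longleftrightarrow> c \<in> edges G \<rightarrow> {..<k}"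

definition mono_subgraph :: "('a set \<Rightarrow> nat) \<Rightarrow> 'a graph \<Rightarrow> bool" where
  "mono_subgraph c S \<longleftrightarrow> (\<forall>e\<in>edges S. \<forall>e'\<in>edges S. c e = c e')"

definition rainbow_subgraph :: "('a set \<Rightarrow> nat) \<Rightarrow> 'a graph \<Rightarrow> bool" where
  "rainbow_subgraph c S \<longleftrightarrow> inj_on c (edges S)"

text \<open>In both definitions below the minimum exists for finite \<open>H\<close> by Ramsey's theorem; \<open>LEAST\<close>
  carries no such information by itself.\<close>

definition gallai_ramsey :: "nat \<Rightarrow> 'a graph \<Rightarrow> 'b graph \<Rightarrow> nat" where
  "gallai_ramsey k G H = (LEAST N. \<forall>c. edge_coloring k (complete_graph N) c \<longrightarrow>
     (\<exists>S. copy_in S G (complete_graph N) \<and> rainbow_subgraph c S) \<or>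
     (\<exists>S. copy_in S H (complete_graph N) \<and> mono_subgraph c S))"

definition ramsey_two :: "'a graph \<Rightarrow> nat" where
  "ramsey_two H = (LEAST N. \<forall>c. edge_coloring 2 (complete_graph N) c \<longrightarrow>
     (\<exists>S. copy_in S H (complete_graph N) \<and> mono_subgraph c S))"

text \<open>The four-cycle \<open>0, 1, 2, 3\<close> with the \<open>n - 2\<close> pendant vertices \<open>4, \<dots>, n + 1\<close> attached
  to \<open>0\<close>; meant for \<open>n \<ge> 2\<close>.\<close>

definition F2 :: "nat \<Rightarrow> nat graph" where
  "F2 n = ({..<n + 2},
     {{0, 1}, {1, 2}, {2, 3}, {3, 0}} \<union> {{0, i} | i. 4 \<le> i \<and> i < n + 2})"

end

theory Submission
  imports Defs
begin

text \<open>Upper bounds. A vertex joined to all others in one color makes that color a matching on the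
  rest, unless a copy of \<open>F\<^sub>2\<^sub>,\<^sub>n\<close> appears; so such vertices can be stripped off, each using up its own
  color. If the remaining set \<open>W\<close> has a cut with a single color across, both sides have fewer than
  \<open>n\<close> vertices. Otherwise Gallai's theorem gives a partition of \<open>W\<close> with exactly two colors between
  the parts. Let \<open>P\<close> be a largest part and let \<open>R\<close>, \<open>B\<close> be the vertices joined to it in these
  two colors. A large \<open>P\<close>, \<open>R\<close> or \<open>B\<close> yields a copy inside the complete bipartite graphs
  \<open>P-R\<close> and \<open>P-B\<close>, and if all parts are small, then a vertex of degree \<open>n\<close> in one of the two
  colors yields a copy around itself in that color or one in the nearly complete rest of the other.

  Lower bounds. Blow-ups of the pentagon coloring of \<open>K\<^sub>5\<close> have small degrees in each color, and each
  further color allows one more vertex, joined to all previous ones in that color.\<close>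

text \<open>The upper bounds come from one count. The stripped vertices use up a set
  \<open>M\<close> of colors that are matchings on \<open>W\<close>, so
  \<open>card V = card W + card M\<close>, and every color that is not a matching on
  \<open>W\<close> lowers the bound on \<open>card M\<close> by one. A set \<open>W\<close> of at
  least three vertices provides one such color, a partition without a cut provides two. This is one
  short in two places: a cut into 3 + 3 vertices for \<open>n = 4\<close>, and a partition of shape
  3 + 4 + 4 for \<open>n = 5\<close>. There the three-vertex side contains two adjacent edges of
  equal color, and this color is a further one outside \<open>M\<close>. For \<open>n = 4\<close>
  without a cut, the sizes alone allow eight vertices, and a parity argument is needed to exclude
  seven.

  The bound in part (3) is the slack form of \<open>3 * n + k - 5\<close>, an estimate that holds in
  all cases.

  Among the lower bounds, \<open>n = 5\<close> gains one vertex over the general construction,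
  because the parts of its blow-up have two vertices and the third color is itself a
  matching.\<close>

lemma card_ge_2E:
  assumes "2 \<le> card A"
  obtains x y where "x \<in> A" "y \<in> A" "x \<noteq> y"
proof -
  obtain B where "B \<subseteq> A" "card B = 2" using assms by (meson obtain_subset_with_card_n)
  then show thesis using that by (auto simp: card_2_iff)
qed

lemma card_le_Diff_plus_Int:
  assumes "finite X"
  shows "card X \<le> card (X - Y) + card (Y \<inter> X)"
proof -
  have "card X = card ((X - Y) \<union> (Y \<inter> X))" by (rule arg_cong[of _ _ card]) auto
  then show ?thesis using card_Un_le by metis
qed

lemma card_eq_3E:
  assumes "card A = 3"
  obtains x y z where "A = {x, y, z}" "x \<noteq> y" "x \<noteq> z" "y \<noteq> z"
  using assms by (auto simp: card_3_iff)

text \<open>Handshake lemma: a new element contributes each of its neighbors in both orders. It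
  later rules out a 3-regular graph on seven vertices.\<close>

lemma even_card_symmetric:
  assumes "finite A" "\<And>x y. R x y \<Longrightarrow> R y x" "\<And>x. \<not> R x x"
  shows "even (card {(x, y) \<in> A \<times> A. R x y})"
  using assms(1)
proof (induction A rule: finite_induct)
  case empty
  then show ?case by simp
next
  case (insert a A)
  let ?N = "{y \<in> A. R a y}"
  have "{(x, y) \<in> insert a A \<times> insert a A. R x y} =
      {(x, y) \<in> A \<times> A. R x y} \<union> ({a} \<times> ?N \<union> ?N \<times> {a})"
    using assms(2,3) by auto
  moreover have "card ({(x, y) \<in> A \<times> A. R x y} \<union> ({a} \<times> ?N \<union> ?N \<times> {a})) =
      card {(x, y) \<in> A \<times> A. R x y} + card ({a} \<times> ?N \<union> ?N \<times> {a})"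
  proof (rule card_Un_disjoint)
    have "{(x, y) \<in> A \<times> A. R x y} \<subseteq> A \<times> A" by auto
    then show "finite {(x, y) \<in> A \<times> A. R x y}"
      using insert(1) by (meson finite_SigmaI finite_subset)
  qed (use insert in auto)
  moreover have "card ({a} \<times> ?N \<union> ?N \<times> {a}) = card ({a} \<times> ?N) + card (?N \<times> {a})"
    by (rule card_Un_disjoint) (use insert in auto)
  ultimately show ?case using insert.IH by (simp add: card_cartesian_product)
qed

section \<open>Symmetric colorings and monochromatic copies of \<open>F2 n\<close>\<close>

locale sym_coloring =
  fixes c :: "'a \<Rightarrow> 'a \<Rightarrow> 'b"
  assumes sym: "c x y = c y x"
begin

definition nbrs :: "'a set \<Rightarrow> 'b \<Rightarrow> 'a \<Rightarrow> 'a set" where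
  "nbrs V r v = {u \<in> V. u \<noteq> v \<and> c v u = r}"

text \<open>A color class contains \<open>F\<^sub>2\<^sub>,\<^sub>n\<close> with center \<open>v\<close> and opposite vertex \<open>w\<close> of the four-cycle. Since
  \<open>w\<close> may itself be a neighbor of \<open>v\<close>, it has to be excluded from the degree count.\<close>

definition has_F :: "nat \<Rightarrow> 'a set \<Rightarrow> bool" where
  "has_F n V \<longleftrightarrow> (\<exists>r. \<exists>v\<in>V. \<exists>w\<in>V. v \<noteq> w \<and>
     2 \<le> card (nbrs V r v \<inter> nbrs V r w) \<and> n \<le> card (nbrs V r v - {w}))"

definition gallai :: "'a set \<Rightarrow> bool" where
  "gallai V \<longleftrightarrow> (\<forall>x\<in>V. \<forall>y\<in>V. \<forall>z\<in>V. x \<noteq> y \<longrightarrow> y \<noteq> z \<longrightarrow> x \<noteq> z \<longrightarrow>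
     c x y = c x z \<or> c x y = c y z \<or> c x z = c y z)"

definition matching :: "'b \<Rightarrow> 'a set \<Rightarrow> bool" where
  "matching r V \<longleftrightarrow> (\<forall>v\<in>V. card (nbrs V r v) \<le> 1)"

definition used :: "'b \<Rightarrow> 'a set \<Rightarrow> bool" where
  "used r V \<longleftrightarrow> (\<exists>x\<in>V. \<exists>y\<in>V. x \<noteq> y \<and> c x y = r)"

text \<open>For nonempty \<open>V\<close> this is connectedness of the graph of color
  \<open>r\<close>. The cut form is the one in which it is proved for quotients and applied to
  single vertices and to components.\<close>

definition spanning :: "'b \<Rightarrow> 'a set \<Rightarrow> bool" where
  "spanning r V \<longleftrightarrow>
     (\<forall>A. A \<subseteq> V \<longrightarrow> A \<noteq> {} \<longrightarrow> A \<noteq> V \<longrightarrow> (\<exists>x\<in>A. \<exists>y\<in>V - A. c x y = r))"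

text \<open>The classes of \<open>E\<close> are modules: between two of them there is just one color.\<close>

definition modular :: "'a set \<Rightarrow> ('a \<times> 'a) set \<Rightarrow> bool" where
  "modular V E \<longleftrightarrow> equiv V E \<and>
     (\<forall>x x' y. (x, x') \<in> E \<longrightarrow> y \<in> V \<longrightarrow> (x, y) \<notin> E \<longrightarrow> c x y = c x' y)"

lemma gallaiD:
  assumes "gallai V" "x \<in> V" "y \<in> V" "z \<in> V" "x \<noteq> y" "y \<noteq> z" "x \<noteq> z"
  shows "c x y = c x z \<or> c x y = c y z \<or> c x z = c y z"
  using assms unfolding gallai_def by blast

lemma usedI: "x \<in> V \<Longrightarrow> y \<in> V \<Longrightarrow> x \<noteq> y \<Longrightarrow> used (c x y) V"
  unfolding used_def by blast

lemma spanningD: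
  assumes "spanning r V" "A \<subseteq> V" "A \<noteq> {}" "A \<noteq> V"
  obtains x y where "x \<in> A" "y \<in> V" "y \<notin> A" "c x y = r"
  using assms unfolding spanning_def by (metis DiffE)

lemma gallai_subset: "gallai V \<Longrightarrow> W \<subseteq> V \<Longrightarrow> gallai W"
  unfolding gallai_def by blast

lemma nbrs_mono: "W \<subseteq> V \<Longrightarrow> nbrs W r v \<subseteq> nbrs V r v"
  unfolding nbrs_def by blast

lemma finite_nbrs: "finite V \<Longrightarrow> finite (nbrs V r v)"
  unfolding nbrs_def by simp

lemma has_FI:
  assumes "finite V" "v \<in> V" "w \<in> V" "v \<noteq> w"
    and "C \<subseteq> nbrs V r v" "C \<subseteq> nbrs V r w" "2 \<le> card C"
    and "D \<subseteq> nbrs V r v" "w \<notin> D" "n \<le> card D"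
  shows "has_F n V"
proof -
  have "card C \<le> card (nbrs V r v \<inter> nbrs V r w)"
    using assms by (intro card_mono) (auto simp: finite_nbrs)
  moreover have "card D \<le> card (nbrs V r v - {w})"
    using assms by (intro card_mono) (auto simp: finite_nbrs)
  ultimately show ?thesis
    unfolding has_F_def using assms by (meson order_trans)
qed

lemma has_F_mono:
  assumes "has_F n W" "W \<subseteq> V" "finite V"
  shows "has_F n V"
proof -
  obtain r v w where vw: "v \<in> W" "w \<in> W" "v \<noteq> w"
    "2 \<le> card (nbrs W r v \<inter> nbrs W r w)" "n \<le> card (nbrs W r v - {w})"
    using assms(1) unfolding has_F_def by blast
  show ?thesis
    by (rule has_FI[OF assms(3), of v w "nbrs W r v \<inter> nbrs W r w" r "nbrs W r v - {w}"])
      (use vw assms(2) nbrs_mono[OF assms(2)] in auto)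
qed

lemma matching_mono:
  assumes "matching r V" "W \<subseteq> V" "finite V"
  shows "matching r W"
  unfolding matching_def
proof
  fix v assume "v \<in> W"
  then have "card (nbrs V r v) \<le> 1" using assms unfolding matching_def by blast
  moreover have "card (nbrs W r v) \<le> card (nbrs V r v)"
    by (intro card_mono finite_nbrs nbrs_mono assms)
  ultimately show "card (nbrs W r v) \<le> 1" by simp
qed

lemma not_matchingI:
  assumes "finite V" "x \<in> V" "y \<in> V" "z \<in> V" "x \<noteq> y" "x \<noteq> z" "y \<noteq> z" "c x y = r" "c x z = r"
  shows "\<not> matching r V"
proof
  assume "matching r V"
  then have "card (nbrs V r x) \<le> 1" using assms unfolding matching_def by blast
  moreover have "card {y, z} \<le> card (nbrs V r x)"
    using assms by (intro card_mono finite_nbrs) (auto simp: nbrs_def)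
  ultimately show False using assms by simp
qed

lemma biclique_has_F:
  assumes "finite V" "A \<subseteq> V" "B \<subseteq> V" "A \<inter> B = {}" "\<And>x y. x \<in> A \<Longrightarrow> y \<in> B \<Longrightarrow> c x y = r"
    and "2 \<le> card A" "n \<le> card B" "2 \<le> n"
  shows "has_F n V"
proof -
  obtain x y where "x \<in> A" "y \<in> A" "x \<noteq> y"
    using assms(6) by (rule card_ge_2E)
  then show ?thesis
    by (intro has_FI[OF assms(1), of x y B r B])
      (use assms in \<open>auto simp: nbrs_def\<close>)
qed

text \<open>\<open>B\<close> may be one vertex too small for the degree of the center
  \<open>x\<close>; the pendant edge to \<open>u\<close> makes up for it, while \<open>y\<close> is
  the opposite vertex of the four-cycle.\<close>

lemma biclique_pendant_has_F:
  assumes "finite V" "A \<subseteq> V" "B \<subseteq> V" "A \<inter> B = {}" "\<And>x y. x \<in> A \<Longrightarrow> y \<in> B \<Longrightarrow> c x y = r"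
    and "n \<le> card B + 1" "3 \<le> n"
    and "x \<in> A" "y \<in> A" "x \<noteq> y" "u \<in> V" "u \<noteq> x" "u \<noteq> y" "u \<notin> B" "c x u = r"
  shows "has_F n V"
proof (rule has_FI[OF assms(1), of x y B r "insert u B"])
  have "finite B" using assms finite_subset by blast
  then show "n \<le> card (insert u B)" using assms by simp
qed (use assms in \<open>auto simp: nbrs_def\<close>)

text \<open>Here \<open>c x u \<noteq> b\<close> defines a graph which is a matching up to one exceptional vertex \<open>x1\<close>;
  the vertex opposite to the centre is a partner of the centre in that graph, if there is one.\<close>

lemma nearly_complete_has_F:
  assumes fin: "finite V" and U: "U \<subseteq> V" and n: "3 \<le> n" and cU: "n + 2 \<le> card U"
    and B1: "\<And>x. x \<in> U \<Longrightarrow> x \<noteq> x1 \<Longrightarrow> card {y \<in> U - {x}. c x y \<noteq> b} \<le> 1"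
    and B2: "\<And>x. x \<in> U \<Longrightarrow> card {y \<in> U - {x}. c x y \<noteq> b} \<le> 2"
  shows "has_F n V"
proof -
  define N where "N x = {y \<in> U - {x}. c x y \<noteq> b}" for x
  have finU: "finite U" using fin U finite_subset by blast
  have "card (U - {x1}) \<ge> 2" using cU n finU by (auto simp: card_Diff_singleton_if)
  then obtain x w0 where x: "x \<in> U" "x \<noteq> x1" and w0: "w0 \<in> U" "w0 \<noteq> x1" "x \<noteq> w0"
    by (rule card_ge_2E) auto
  obtain w where w: "w \<in> U" "w \<noteq> x" "N x \<subseteq> {w}" "card (N w - {x}) \<le> 1"
  proof (cases "N x = {}")
    case True
    have "card (N w0 - {x}) \<le> card (N w0)" by (intro card_mono) (auto simp: N_def finU)
    also have "\<dots> \<le> 1" using B1 w0 unfolding N_def by blast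
    finally show thesis using that[of w0] True w0 by auto
  next
    case False
    have fN: "finite (N x)" for x unfolding N_def using finU by simp
    have "card (N x) \<le> 1" using B1 x unfolding N_def by blast
    then have "card (N x) = 1" using False fN by (metis One_nat_def Suc_leI card_gt_0_iff le_antisym)
    then obtain w where w: "N x = {w}" by (auto simp: card_1_singleton_iff)
    then have "w \<in> N x" by simp
    then have w': "w \<in> U" "w \<noteq> x" "x \<in> N w" using x sym unfolding N_def by auto
    have "card (N w) \<le> 2" using B2 w' unfolding N_def by blast
    then have "card (N w - {x}) \<le> 1" using w' fN by simp
    then show thesis using that w w' by auto
  qed
  \<comment> \<open>Center and opposite vertex cost two of the \<open>n + 2\<close> vertices. Apart
    from \<open>x\<close>, the vertex \<open>w\<close> misses at most one more, so at least
    \<open>n - 1 \<ge> 2\<close> common neighbors remain.\<close>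
  have D: "card (U - {x, w}) \<ge> n"
    using cU w x finU by (simp add: card_Diff_subset)
  have "(U - {x, w}) - (N w - {x}) = U - {x, w} - N w" by auto
  moreover have "card (U - {x, w}) - card (N w - {x}) \<le> card ((U - {x, w}) - (N w - {x}))"
    by (intro diff_card_le_card_Diff) (simp add: N_def finU)
  ultimately have C: "2 \<le> card (U - {x, w} - N w)" using D w(4) n by simp
  show ?thesis
    by (rule has_FI[OF fin, of x w "U - {x, w} - N w" b "U - {x, w}"])
      (use x w U C D in \<open>auto simp: nbrs_def N_def\<close>)
qed

subsection \<open>Gallai partitions\<close>

text \<open>By the absence of rainbow triangles, a vertex sees the two ends of an edge of color \<open>q\<close> in the
  same color unless it is itself joined to one of them in color \<open>q\<close>.\<close>

lemma merge_modular:
  assumes m: "modular V E" and g: "gallai V"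
    and D: "D = {(x, y) \<in> V \<times> V. (x, y) \<in> E \<or> c x y = q}"
  shows "modular V (D\<^sup>+)" "E \<subseteq> D\<^sup>+" "D \<subseteq> D\<^sup>+"
    "\<And>x y. x \<in> V \<Longrightarrow> y \<in> V \<Longrightarrow> (x, y) \<notin> D\<^sup>+ \<Longrightarrow> c x y \<noteq> q"
proof -
  have eq: "equiv V E" using m unfolding modular_def by blast
  have EV: "E \<subseteq> V \<times> V" using eq equiv_type by blast
  have symE: "sym_on UNIV E" using eq unfolding equiv_def by blast
  have sub: "D\<^sup>+ \<subseteq> V \<times> V" by (rule trancl_subset_Sigma) (auto simp: D)
  show ED: "E \<subseteq> D\<^sup>+" using EV D by auto
  show DD: "D \<subseteq> D\<^sup>+" by auto
  show nq: "c x y \<noteq> q" if "x \<in> V" "y \<in> V" "(x, y) \<notin> D\<^sup>+" for x y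
    using that DD D by auto
  have "sym_on UNIV D" using symE sym unfolding D sym_on_def by auto
  then have symD: "sym_on UNIV (D\<^sup>+)" by (rule sym_trancl)
  have "refl_on V (D\<^sup>+)" using eq ED unfolding equiv_def refl_on_def by auto
  then have eqD: "equiv V (D\<^sup>+)"
    using symD sub trans_trancl by (auto simp: equiv_def)
  have step: "c x y = c x' y" if "(x, x') \<in> D" "(x, y) \<notin> D\<^sup>+" "y \<in> V" for x x' y
  proof (cases "(x, x') \<in> E")
    case True
    then show ?thesis using m that ED unfolding modular_def by blast
  next
    case False
    have V: "x \<in> V" "x' \<in> V" "c x x' = q" using that(1) False D by auto
    have n: "(x', y) \<notin> D\<^sup>+" using that by (meson trancl_into_trancl2)
    have "c x y \<noteq> q" "c x' y \<noteq> q" using nq V that n by auto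
    moreover have "x \<noteq> y" "x' \<noteq> y" "x \<noteq> x'"
      using that V n eqD False eq unfolding equiv_def refl_on_def by auto
    ultimately show ?thesis using gallaiD[OF g, of x x' y] V that by auto
  qed
  have "c x y = c x' y" if "(x, x') \<in> D\<^sup>+" "(x, y) \<notin> D\<^sup>+" "y \<in> V" for x x' y
    using that
  proof (induction rule: trancl_induct)
    case (base z)
    then show ?case using step by blast
  next
    case (step z w)
    have "(z, y) \<notin> D\<^sup>+" using step by (meson trancl_trans)
    then show ?case using step \<open>\<And>x x' y. _ \<Longrightarrow> _ \<Longrightarrow> _ \<Longrightarrow> c x y = c x' y\<close> by metis
  qed
  then show "modular V (D\<^sup>+)" using eqD unfolding modular_def by blast
qed

lemma trancl_stays:
  assumes "(x, y) \<in> D\<^sup>+" "x \<in> A" "\<And>x y. (x, y) \<in> D \<Longrightarrow> x \<in> A \<Longrightarrow> y \<in> A"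
  shows "y \<in> A"
  using assms(1,2) by (induction rule: trancl_induct) (auto intro: assms(3))

lemma modular_Id_on: "modular V (Id_on V)"
  unfolding modular_def equiv_def by (auto simp: refl_on_Id_on sym_Id_on trans_Id_on)

lemma modularD:
  assumes "modular V E" "(a, a') \<in> E" "(b, b') \<in> E" "(a, b) \<notin> E"
  shows "c a b = c a' b'"
proof -
  have E: "equiv V E" using assms(1) unfolding modular_def by blast
  then have EV: "E \<subseteq> V \<times> V" using equiv_type by blast
  have V: "b \<in> V" "a' \<in> V" using assms EV by auto
  have "c a b = c a' b" using assms V unfolding modular_def by blast
  moreover have "(b, a') \<notin> E" using assms E by (meson equivE symE transE)
  then have "c b a' = c b' a'" using assms V unfolding modular_def by blast
  ultimately show ?thesis using sym by metis
qed

text \<open>Induction on the number of vertices. If \<open>q\<close> does not span \<open>V\<close> but spans \<open>insert x V\<close>, then \<open>x\<close>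
  sends an edge of color \<open>q\<close> to every \<open>q\<close>-component of \<open>V\<close>; as distinct components are joined in one
  color other than \<open>q\<close>, two further colors at \<open>x\<close> create a rainbow triangle.\<close>

lemma unspanned_used_color:
  assumes "finite V" "gallai V"
    and "used r1 V" "used r2 V" "used r3 V" "r1 \<noteq> r2" "r1 \<noteq> r3" "r2 \<noteq> r3"
  shows "\<exists>q. used q V \<and> \<not> spanning q V"
  using assms(1-5)
proof (induction V rule: finite_induct)
  case empty
  then show ?case by (auto simp: used_def)
next
  case (insert x V)
  show ?case
  proof (rule ccontr)
    assume contra: "\<not> ?thesis"
    then have span: "\<And>q. used q (insert x V) \<Longrightarrow> spanning q (insert x V)" by blast
    have g: "gallai (insert x V)" by fact
    then have gV: "gallai V" by (rule gallai_subset) auto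
    have "V \<noteq> {}" using insert.prems(2) by (auto simp: used_def)
    have at_x: "\<exists>y\<in>V. c x y = q" if "used q (insert x V)" for q
    proof -
      have "{x} \<subseteq> insert x V" "{x} \<noteq> {}" "{x} \<noteq> insert x V" using \<open>V \<noteq> {}\<close> insert(2) by auto
      then show ?thesis by (rule spanningD[OF span[OF that]]) auto
    qed
    show False
    proof (cases "used r1 V \<and> used r2 V \<and> used r3 V")
      case False
      then obtain g h where gh: "used g (insert x V)" "used h (insert x V)" "g \<noteq> h" "\<not> used g V"
        using insert.prems assms(6-8) by metis
      \<comment> \<open>Color \<open>g\<close> does not occur inside \<open>V\<close>, yet some edge
        of this color has to leave each \<open>{y}\<close>. So all edges at \<open>x\<close> have
        color \<open>g\<close>, and none is left for \<open>h\<close>.\<close>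
      have "c x y = g" if "y \<in> V" for y
      proof -
        have "{y} \<subseteq> insert x V" "{y} \<noteq> {}" "{y} \<noteq> insert x V" using that insert(2) by auto
        then obtain u where u: "u \<in> insert x V" "u \<noteq> y" "c y u = g"
          by (rule spanningD[OF span[OF gh(1)]]) auto
        then have "u = x" using gh(4) usedI[of y V u] that by auto
        then show ?thesis using u sym by metis
      qed
      then show False using at_x[OF gh(2)] gh(3) by auto
    next
      case True
      then obtain q where q: "used q V" "\<not> spanning q V" using insert.IH gV by blast
      have q': "used q (insert x V)" using q unfolding used_def by blast
      obtain p s where ps: "p \<noteq> q" "s \<noteq> q" "p \<noteq> s" "used p (insert x V)" "used s (insert x V)"
        using insert.prems assms(6-8) by metis
      obtain y where y: "y \<in> V" "c x y = p" using at_x ps by blast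
      obtain z where z: "z \<in> V" "c x z = s" using at_x ps by blast
      define D where "D = {(u, v) \<in> V \<times> V. (u, v) \<in> Id_on V \<or> c u v = q}"
      note mm = merge_modular[OF modular_Id_on gV D_def]
      have E: "equiv V (D\<^sup>+)" using mm(1) unfolding modular_def by blast
      have EV: "D\<^sup>+ \<subseteq> V \<times> V" using E equiv_type by blast
      have Esym: "(b, a) \<in> D\<^sup>+" if "(a, b) \<in> D\<^sup>+" for a b
        using E that by (meson equivE symE)
      have Erefl: "(a, a) \<in> D\<^sup>+" if "a \<in> V" for a
        using mm(2) that by auto
      note mod = modularD[OF mm(1)]
      obtain A where A: "A \<subseteq> V" "A \<noteq> {}" "A \<noteq> V" "\<And>a b. a \<in> A \<Longrightarrow> b \<in> V - A \<Longrightarrow> c a b \<noteq> q"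
        using q(2) unfolding spanning_def by blast
      have not_all: "\<exists>w\<in>V. (w, a) \<notin> D\<^sup>+" if "a \<in> V" for a
      proof -
        obtain a1 where a1: "a1 \<in> A" using A by blast
        obtain b where b: "b \<in> V - A" using A by blast
        have "(a1, b) \<notin> D\<^sup>+"
        proof
          assume "(a1, b) \<in> D\<^sup>+"
          then have "b \<in> A" by (rule trancl_stays[OF _ a1]) (use A(4) in \<open>auto simp: D_def\<close>)
          then show False using b by simp
        qed
        then show ?thesis using a1 b A(1) Esym by (meson Diff_iff subsetD trancl_trans)
      qed
      have q_at: "\<exists>w'. (w, w') \<in> D\<^sup>+ \<and> c x w' = q" if w: "w \<in> V" for w
      proof -
        let ?C = "D\<^sup>+ `` {w}"
        have "?C \<subseteq> insert x V" "?C \<noteq> {}" "?C \<noteq> insert x V"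
          using EV Erefl[OF w] insert(2) by auto
        then obtain a u where au: "(w, a) \<in> D\<^sup>+" "u \<in> insert x V" "(w, u) \<notin> D\<^sup>+" "c a u = q"
          by (rule spanningD[OF span[OF q']]) auto
        have "u \<notin> V"
        proof
          assume "u \<in> V"
          then have "(a, u) \<in> D" using au EV unfolding D_def by auto
          then show False using au by (meson trancl.intros(2))
        qed
        then show ?thesis using au sym by auto
      qed
      have tri: "c x a = c x b \<or> c x a = c a b \<or> c x b = c a b" if "a \<in> V" "b \<in> V" "a \<noteq> b" for a b
        using gallaiD[OF g, of x a b] that insert(2) by auto
      \<comment> \<open>If \<open>y\<close> and \<open>z\<close> lie in different components, the
        triangles \<open>x, y, b\<close> and \<open>x, a, z\<close> each have one edge of color
        \<open>q\<close> at \<open>x\<close>, which forces both \<open>p\<close> and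
        \<open>s\<close> to be the single color between the two components. If they lie in the same
        one, a vertex \<open>w'\<close> of another component with \<open>c x w' = q\<close> sees
        \<open>y\<close> and \<open>z\<close> in one color, and the triangles through
        \<open>x\<close> and \<open>w'\<close> force \<open>p\<close> and \<open>s\<close> to equal
        it.\<close>
      show False
      proof (cases "(y, z) \<in> D\<^sup>+")
        case False
        have neq: "c y z \<noteq> q" using mm(4) y z False by blast
        obtain a where a: "(y, a) \<in> D\<^sup>+" "c x a = q" using q_at y by blast
        obtain b where b: "(z, b) \<in> D\<^sup>+" "c x b = q" using q_at z by blast
        have 1: "c a z = c y z" "c y b = c y z"
          using mod[of y a z z] mod[of y y z b] a b y z False Erefl by auto
        have "y \<noteq> b" "a \<noteq> z" using a b False Esym by auto
        then have "c x y = c y b" "c x z = c a z"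
          using tri[of y b] tri[of a z] a b y z 1 neq ps EV by auto
        then show False using 1 y z ps by auto
      next
        case True
        obtain w where w: "w \<in> V" "(w, y) \<notin> D\<^sup>+" using not_all y by blast
        obtain w' where w': "(w, w') \<in> D\<^sup>+" "c x w' = q" using q_at w by blast
        have wV: "w' \<in> V" using w' EV by auto
        have wy: "(w', y) \<notin> D\<^sup>+" using w w' by (meson trancl_trans)
        then have wz: "(w', z) \<notin> D\<^sup>+" using True Esym by (meson trancl_trans)
        have 1: "c w' y = c w' z" using mod[of w' w' y z] True wy Erefl wV by auto
        have 2: "c w' y \<noteq> q" using mm(4) wy wV y by blast
        have "w' \<noteq> y" "w' \<noteq> z" using wy wz Erefl y z by auto
        then have "c x y = c w' y" "c x z = c w' z"
          using tri[of w' y] tri[of w' z] wV y z w' 1 2 ps by auto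
        then show False using 1 y z ps by auto
      qed
    qed
  qed
qed

definition mono_cut :: "'a set \<Rightarrow> 'a set \<Rightarrow> 'b \<Rightarrow> bool" where
  "mono_cut V A q \<longleftrightarrow> A \<subseteq> V \<and> A \<noteq> {} \<and> A \<noteq> V \<and> (\<forall>x\<in>A. \<forall>y\<in>V - A. c x y = q)"

definition saturated :: "('a \<times> 'a) set \<Rightarrow> 'a set \<Rightarrow> bool" where
  "saturated E A \<longleftrightarrow> (\<forall>x y. (x, y) \<in> E \<longrightarrow> x \<in> A \<longrightarrow> y \<in> A)"

text \<open>Choose a maximal modular \<open>E\<close> other than \<open>V \<times> V\<close>. Merging the classes along a color that occurs
  between them must give everything, so each such color spans the quotient.\<close>

lemma gallai_partition:
  assumes fin: "finite V" and V2: "2 \<le> card V" and g: "gallai V"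
  obtains E r b where "modular V E" "E \<noteq> V \<times> V"
    "\<And>x y. x \<in> V \<Longrightarrow> y \<in> V \<Longrightarrow> (x, y) \<notin> E \<Longrightarrow> c x y \<in> {r, b}"
    "\<And>q A x y. x \<in> V \<Longrightarrow> y \<in> V \<Longrightarrow> (x, y) \<notin> E \<Longrightarrow> c x y = q \<Longrightarrow> saturated E A \<Longrightarrow>
       A \<subseteq> V \<Longrightarrow> A \<noteq> {} \<Longrightarrow> A \<noteq> V \<Longrightarrow> \<exists>x\<in>A. \<exists>y\<in>V - A. c x y = q"
proof -
  let ?P = "\<lambda>E. modular V E \<and> E \<noteq> V \<times> V"
  have "?P (Id_on V)"
  proof -
    obtain a b where "a \<in> V" "b \<in> V" "a \<noteq> b" using V2 by (rule card_ge_2E)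
    then show ?thesis using modular_Id_on by auto
  qed
  moreover have bound: "\<forall>E. ?P E \<longrightarrow> card E < Suc (card (V \<times> V))"
  proof (intro allI impI)
    fix E assume "?P E"
    then have "E \<subseteq> V \<times> V" unfolding modular_def using equiv_type by blast
    then show "card E < Suc (card (V \<times> V))" using card_mono fin finite_SigmaI by (metis less_Suc_eq_le)
  qed
  ultimately obtain E where E: "?P E" and max: "\<And>E'. ?P E' \<Longrightarrow> card E' \<le> card E"
    using ex_has_greatest_nat[of ?P "Id_on V" card "Suc (card (V \<times> V))"] by (metis less_le_not_le nat_le_linear)
  have m: "modular V E" and ne: "E \<noteq> V \<times> V" using E by auto
  have eq: "equiv V E" using m unfolding modular_def by blast
  have EV: "E \<subseteq> V \<times> V" using eq equiv_type by blast
  have Erefl: "(a, a) \<in> E" if "a \<in> V" for a using eq that by (meson equivE refl_onD)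
  have Esym: "(b, a) \<in> E" if "(a, b) \<in> E" for a b using eq that by (meson equivE symE)
  have Etrans: "(a, d) \<in> E" if "(a, b) \<in> E" "(b, d) \<in> E" for a b d using eq that by (meson equivE transE)
  have cross: "\<exists>x\<in>A. \<exists>y\<in>V - A. c x y = q"
    if xy: "x \<in> V" "y \<in> V" "(x, y) \<notin> E" "c x y = q" and sat: "saturated E A"
      and A: "A \<subseteq> V" "A \<noteq> {}" "A \<noteq> V" for q A x y
  proof (rule ccontr)
    assume no: "\<not> ?thesis"
    define D where "D = {(u, v) \<in> V \<times> V. (u, v) \<in> E \<or> c u v = q}"
    note mm = merge_modular[OF m g D_def]
    have "(x, y) \<in> D\<^sup>+" using xy unfolding D_def by auto
    then have "E \<subset> D\<^sup>+" using mm(2) xy by auto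
    moreover have "D\<^sup>+ \<subseteq> V \<times> V" using mm(1) equiv_type unfolding modular_def by blast
    then have "finite (D\<^sup>+)" by (rule finite_subset) (simp add: fin)
    ultimately have "card E < card (D\<^sup>+)" by (simp add: psubset_card_mono)
    then have full: "D\<^sup>+ = V \<times> V" using max[of "D\<^sup>+"] mm(1) by fastforce
    obtain a b where ab: "a \<in> A" "b \<in> V - A" using A by blast
    then have "(a, b) \<in> D\<^sup>+" using full A by auto
    then have "b \<in> A"
      by (rule trancl_stays[OF _ ab(1)]) (use no sat in \<open>auto simp: D_def saturated_def\<close>)
    then show False using ab by auto
  qed
  \<comment> \<open>\<open>V0\<close> has one vertex per class, so \<open>c\<close> on
    \<open>V0\<close> is the quotient coloring. All colors used there span it, and
    \<open>unspanned_used_color\<close> then allows at most two of them.\<close>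
  define rep where "rep x = (SOME y. (x, y) \<in> E)" for x
  define V0 where "V0 = rep ` V"
  have rep: "(x, rep x) \<in> E" if "x \<in> V" for x
    unfolding rep_def using Erefl[OF that] by (rule someI)
  have rep_eq: "rep x = rep y" if "(x, y) \<in> E" for x y
  proof -
    have "(x, z) \<in> E \<longleftrightarrow> (y, z) \<in> E" for z using that Esym Etrans by blast
    then show ?thesis unfolding rep_def by simp
  qed
  have V0V: "V0 \<subseteq> V" unfolding V0_def using rep EV by auto
  have V0_sep: "(u, v) \<notin> E" if uv0: "u \<in> V0" "v \<in> V0" "u \<noteq> v" for u v
  proof
    assume uv: "(u, v) \<in> E"
    obtain x y where "x \<in> V" "y \<in> V" "u = rep x" "v = rep y" using uv0 unfolding V0_def by auto
    then have "(x, y) \<in> E" using uv rep Esym Etrans by metis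
    then show False using rep_eq uv0 \<open>u = rep x\<close> \<open>v = rep y\<close> by auto
  qed
  have "spanning q V0" if q: "used q V0" for q
    unfolding spanning_def
  proof (intro allI impI)
    fix A0 assume A0: "A0 \<subseteq> V0" "A0 \<noteq> {}" "A0 \<noteq> V0"
    obtain x y where xy: "x \<in> V0" "y \<in> V0" "x \<noteq> y" "c x y = q" using q unfolding used_def by blast
    let ?A = "{x \<in> V. rep x \<in> A0}"
    have "saturated E ?A" unfolding saturated_def using rep_eq EV by auto
    moreover have "?A \<noteq> {}" "?A \<noteq> V" using A0 unfolding V0_def by auto
    ultimately obtain u v where uv: "u \<in> ?A" "v \<in> V - ?A" "c u v = q"
      using cross[of x y q ?A] xy V0V V0_sep by auto
    then have "(u, v) \<notin> E" using rep_eq by auto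
    then have "c (rep u) (rep v) = q" using modularD[OF m rep[of u] rep[of v]] uv by auto
    moreover have "rep u \<in> A0" "rep v \<in> V0 - A0" using uv unfolding V0_def by auto
    ultimately show "\<exists>x\<in>A0. \<exists>y\<in>V0 - A0. c x y = q" by blast
  qed
  moreover have "finite V0" "gallai V0" using V0V fin g gallai_subset finite_subset by auto
  ultimately have few: "r1 = r2 \<or> r1 = r3 \<or> r2 = r3"
    if "used r1 V0" "used r2 V0" "used r3 V0" for r1 r2 r3
    using unspanned_used_color that by metis
  then obtain r b where rb: "\<And>q. used q V0 \<Longrightarrow> q \<in> {r, b}"
    by (metis insert_iff)
  have "c x y \<in> {r, b}" if "x \<in> V" "y \<in> V" "(x, y) \<notin> E" for x y
  proof -
    have "c x y = c (rep x) (rep y)" using modularD[OF m rep rep] that by auto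
    moreover have "rep x \<noteq> rep y" using rep that Esym Etrans by metis
    ultimately have "used (c x y) V0" unfolding used_def V0_def using that by auto
    then show ?thesis by (rule rb)
  qed
  then show thesis using that m ne cross by blast
qed

text \<open>Only \<open>r\<close> and \<open>b\<close> lead out of a class. If they were equal, or
  one of them were missing there, the class would be one side of a monochromatic cut. So both occur
  between classes, and hence both cross every union of classes.\<close>

lemma gallai_decomposition:
  assumes fin: "finite V" and V2: "2 \<le> card V" and g: "gallai V"
    and nocut: "\<And>A q. \<not> mono_cut V A q"
  obtains E r b where "r \<noteq> b" "modular V E" "E \<noteq> V \<times> V"
    "\<And>x y. x \<in> V \<Longrightarrow> y \<in> V \<Longrightarrow> (x, y) \<notin> E \<Longrightarrow> c x y \<in> {r, b}"
    "\<And>q A. q \<in> {r, b} \<Longrightarrow> saturated E A \<Longrightarrow>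
       A \<subseteq> V \<Longrightarrow> A \<noteq> {} \<Longrightarrow> A \<noteq> V \<Longrightarrow> \<exists>x\<in>A. \<exists>y\<in>V - A. c x y = q"
proof -
  obtain E r b where m: "modular V E" and ne: "E \<noteq> V \<times> V"
    and col: "\<And>x y. x \<in> V \<Longrightarrow> y \<in> V \<Longrightarrow> (x, y) \<notin> E \<Longrightarrow> c x y \<in> {r, b}"
    and cross: "\<And>q A x y. x \<in> V \<Longrightarrow> y \<in> V \<Longrightarrow> (x, y) \<notin> E \<Longrightarrow> c x y = q \<Longrightarrow> saturated E A \<Longrightarrow>
       A \<subseteq> V \<Longrightarrow> A \<noteq> {} \<Longrightarrow> A \<noteq> V \<Longrightarrow> \<exists>x\<in>A. \<exists>y\<in>V - A. c x y = q"
    by (rule gallai_partition[OF fin V2 g]) (rule that)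
  have eq: "equiv V E" using m unfolding modular_def by blast
  have EV: "E \<subseteq> V \<times> V" using eq equiv_type by blast
  obtain x0 y0 where xy0: "x0 \<in> V" "y0 \<in> V" "(x0, y0) \<notin> E" using ne EV by auto
  let ?A = "E `` {x0}"
  have A: "?A \<subseteq> V" "?A \<noteq> {}" "?A \<noteq> V"
    using xy0 EV eq by (auto simp: equiv_def refl_on_def)
  have out: "(x, y) \<notin> E" if "x \<in> ?A" "y \<in> V - ?A" for x y
    using that eq unfolding equiv_def by (auto dest: transD)
  have used: "\<exists>x\<in>?A. \<exists>y\<in>V - ?A. c x y = q" if q: "q \<in> {r, b}" for q
  proof (rule ccontr)
    assume no: "\<not> ?thesis"
    obtain q' where "{r, b} \<subseteq> {q, q'}" using q by auto
    then have "c x y = q'" if "x \<in> ?A" "y \<in> V - ?A" for x y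
      using col[of x y] out[OF that] no that A by blast
    then show False using nocut[of ?A q'] A unfolding mono_cut_def by blast
  qed
  have "r \<noteq> b"
  proof
    assume "r = b"
    then have "c x y = r" if "x \<in> ?A" "y \<in> V - ?A" for x y
      using col[of x y] out[OF that] that A by blast
    then show False using nocut[of ?A r] A unfolding mono_cut_def by blast
  qed
  moreover have "\<exists>x\<in>A. \<exists>y\<in>V - A. c x y = q"
    if qA: "q \<in> {r, b}" "saturated E A" "A \<subseteq> V" "A \<noteq> {}" "A \<noteq> V" for q A
  proof -
    obtain x y where "x \<in> ?A" "y \<in> V - ?A" "c x y = q" using used qA by blast
    then show ?thesis using cross[of x y q A] out[of x y] A qA by blast
  qed
  ultimately show thesis using that m ne col by blast
qed

subsection \<open>Upper bounds\<close>

text \<open>The colors in \<open>M\<close> are not matchings on \<open>V\<close>: this keeps the colors of successively stripped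
  vertices distinct.\<close>

lemma strip_dominating:
  assumes "finite V" "finite K" "\<not> has_F n V"
    and "\<And>x y. x \<in> V \<Longrightarrow> y \<in> V \<Longrightarrow> x \<noteq> y \<Longrightarrow> c x y \<in> K"
    and "1 \<le> n"
  shows "\<exists>W M. W \<subseteq> V \<and> M \<subseteq> K \<and> card V = card W + card M \<and>
    (\<forall>q\<in>M. matching q W \<and> \<not> matching q V) \<and>
    (card W \<le> n + 1 \<or> (\<forall>v\<in>W. \<forall>q. \<exists>u\<in>W - {v}. c v u \<noteq> q))"
  using assms(1-4)
proof (induction "card V" arbitrary: V rule: less_induct)
  case less
  show ?case
  proof (cases "card V \<le> n + 1 \<or> (\<forall>v\<in>V. \<forall>q. \<exists>u\<in>V - {v}. c v u \<noteq> q)")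
    case True
    then show ?thesis by (intro exI[of _ V] exI[of _ "{}"]) auto
  next
    case False
    then obtain v q where big: "card V > n + 1" and v: "v \<in> V" "\<And>u. u \<in> V \<Longrightarrow> u \<noteq> v \<Longrightarrow> c v u = q"
      by auto
    let ?V = "V - {v}"
    have cV: "card V = Suc (card ?V)"
      using v(1) less.prems(1) by (simp only: card_Suc_Diff1)
    have "\<not> has_F n ?V" using has_F_mono[of n ?V V] less.prems by auto
    then obtain W M where IH: "W \<subseteq> ?V" "M \<subseteq> K" "card ?V = card W + card M"
      "\<And>q. q \<in> M \<Longrightarrow> matching q W \<and> \<not> matching q ?V"
      "card W \<le> n + 1 \<or> (\<forall>v\<in>W. \<forall>q. \<exists>u\<in>W - {v}. c v u \<noteq> q)"
      using less.hyps[of ?V] less.prems cV by (metis Diff_iff finite_Diff lessI)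
    have matV: "matching q ?V"
      unfolding matching_def
    proof
      fix w assume w: "w \<in> ?V"
      show "card (nbrs ?V q w) \<le> 1"
      proof (rule ccontr)
        assume "\<not> card (nbrs ?V q w) \<le> 1"
        then have C: "2 \<le> card (nbrs ?V q w)" by simp
        have "card (V - {v, w}) \<ge> n"
          using big v(1) w less.prems(1) by (auto simp: card_Diff_subset)
        then have "has_F n V"
          by (intro has_FI[of V v w "nbrs ?V q w" q "V - {v, w}"])
            (use less.prems(1) v w C in \<open>auto simp: nbrs_def\<close>)
        then show False using less.prems by blast
      qed
    qed
    have "q \<notin> M" using IH(4) matV by blast
    moreover have "finite M" using IH(2) less.prems(2) finite_subset by blast
    ultimately have cM: "card (insert q M) = Suc (card M)" by simp
    obtain y z where yz: "y \<in> ?V" "z \<in> ?V" "y \<noteq> z"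
    proof (rule card_ge_2E)
      show "2 \<le> card (?V)" using big cV assms(5) by simp
    qed auto
    have "q \<in> K" using less.prems(4)[of v y] v yz by auto
    have "\<not> matching q V"
      by (rule not_matchingI[of V v y z]) (use less.prems v yz in auto)
    moreover have "\<not> matching g V" if "g \<in> M" for g
      using IH(4)[OF that] matching_mono[of g V ?V] less.prems(1) by blast
    moreover have "matching q W" using matching_mono[OF matV IH(1)] less.prems(1) by simp
    ultimately show ?thesis
      using IH cV cM \<open>q \<in> K\<close> by (intro exI[of _ W] exI[of _ "insert q M"]) auto
  qed
qed

text \<open>Two of the three edges inside \<open>A\<close> share a color \<open>g\<close>, so
  \<open>g\<close> is not a matching. Were \<open>g\<close> also the color from \<open>A\<close> to
  a set \<open>B\<close> of \<open>n - 1\<close> vertices, one of these edges would be the pendant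
  edge that \<open>biclique_pendant_has_F\<close> asks for. This supplies the extra color in the
  tight cases.\<close>

lemma mono_cherry_in_triangle:
  assumes "finite V" "gallai V" "A \<subseteq> V" "card A = 3" "3 \<le> n"
  obtains g where "\<not> matching g V" "used g V"
    "\<And>B q. B \<subseteq> V \<Longrightarrow> A \<inter> B = {} \<Longrightarrow> (\<And>x y. x \<in> A \<Longrightarrow> y \<in> B \<Longrightarrow> c x y = q) \<Longrightarrow>
      n \<le> card B + 1 \<Longrightarrow> \<not> has_F n V \<Longrightarrow> g \<noteq> q"
proof -
  obtain x y z where A: "A = {x, y, z}" and d: "x \<noteq> y" "x \<noteq> z" "y \<noteq> z"
    using assms(4) by (rule card_eq_3E)
  have "c x y = c x z \<or> c x y = c y z \<or> c x z = c y z"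
    using gallaiD[OF assms(2), of x y z] A d assms(3) by auto
  then obtain u v w where uvw: "u \<in> A" "v \<in> A" "w \<in> A" "u \<noteq> v" "u \<noteq> w" "v \<noteq> w" "c u v = c u w"
    using A d sym by (metis insertCI)
  show thesis
  proof (rule that[of "c u v"])
    show "\<not> matching (c u v) V"
      by (rule not_matchingI[of V u v w]) (use uvw assms in auto)
    show "used (c u v) V" using uvw assms(3) by (intro usedI) auto
    fix B q assume B: "B \<subseteq> V" "A \<inter> B = {}" "\<And>x y. x \<in> A \<Longrightarrow> y \<in> B \<Longrightarrow> c x y = q"
      "n \<le> card B + 1" "\<not> has_F n V"
    show "c u v \<noteq> q"
    proof
      assume "c u v = q"
      then have "has_F n V"
        by (intro biclique_pendant_has_F[of V A B q n u w v]) (use uvw assms B in auto)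
      then show False using B by blast
    qed
  qed
qed

section \<open>Monochromatic cuts\<close>

text \<open>Each side has at most \<open>n - 1\<close> vertices, and the color of the cut is not in
  \<open>M\<close>. For \<open>n = 4\<close> only the cut into 3 + 3 vertices needs more: two edges
  of equal color inside \<open>A\<close> give a second color outside \<open>M\<close>.\<close>

lemma mono_cut_bound:
  assumes fin: "finite W" and g: "gallai W" and noF: "\<not> has_F n W" and n: "3 \<le> n"
    and cut: "mono_cut W A q" and A2: "2 \<le> card A" and B2: "2 \<le> card (W - A)"
    and K: "finite K" "\<And>x y. x \<in> W \<Longrightarrow> y \<in> W \<Longrightarrow> x \<noteq> y \<Longrightarrow> c x y \<in> K"
    and M: "M \<subseteq> K" "\<And>p. p \<in> M \<Longrightarrow> matching p W"
  shows "card W + card M + 3 \<le> 2 * n + card K"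
    and "n = 4 \<Longrightarrow> card W + card M \<le> card K + 4"
proof -
  let ?B = "W - A"
  have AW: "A \<subseteq> W" and cross: "\<And>x y. x \<in> A \<Longrightarrow> y \<in> ?B \<Longrightarrow> c x y = q"
    using cut unfolding mono_cut_def by auto
  then have cross': "\<And>x y. x \<in> ?B \<Longrightarrow> y \<in> A \<Longrightarrow> c x y = q" using sym by metis
  have finA: "finite A" using AW fin finite_subset by blast
  have cW: "card W = card A + card ?B"
    using AW finA fin by (simp add: card_Diff_subset card_mono)
  have "card ?B < n"
  proof (rule ccontr)
    assume "\<not> ?thesis"
    then have "has_F n W"
      by (intro biclique_has_F[of W A ?B q n]) (use fin AW cross A2 n in auto)
    then show False using noF by blast
  qed
  moreover have "card A < n"
  proof (rule ccontr)
    assume "\<not> ?thesis"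
    then have "has_F n W"
      by (intro biclique_has_F[of W ?B A q n]) (use fin AW cross' B2 n in auto)
    then show False using noF by blast
  qed
  ultimately have small: "card A < n" "card ?B < n" by auto
  obtain a a' where a: "a \<in> A" "a' \<in> A" "a \<noteq> a'" using A2 by (rule card_ge_2E)
  obtain b b' where b: "b \<in> ?B" "b' \<in> ?B" "b \<noteq> b'" using B2 by (rule card_ge_2E)
  have "\<not> matching q W"
    by (rule not_matchingI[of W a b b']) (use fin a b AW cross in auto)
  then have qM: "q \<notin> M" using M by blast
  have "c a b \<in> K" using K(2)[of a b] a b AW by auto
  then have qK: "q \<in> K" using cross a b by simp
  have "M \<subseteq> K - {q}" using M qM by blast
  then have "card M \<le> card (K - {q})" using K(1) by (intro card_mono) auto
  then have cM: "card M < card K" using qK K(1) by (metis card_Diff1_less le_less_trans)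
  show "card W + card M + 3 \<le> 2 * n + card K" using cW small cM by linarith
  show "card W + card M \<le> card K + 4" if n4: "n = 4"
  proof (cases "card W \<le> 5")
    case True
    then show ?thesis using cM by linarith
  next
    case False
    then have c3: "card A = 3" "card ?B = 3" using cW small n4 by auto
    obtain p where p: "\<not> matching p W" "used p W" "p \<noteq> q"
    proof (rule mono_cherry_in_triangle[OF fin g AW c3(1) n])
      fix p assume *: "\<not> matching p W" "used p W"
        "\<And>B q. B \<subseteq> W \<Longrightarrow> A \<inter> B = {} \<Longrightarrow> (\<And>x y. x \<in> A \<Longrightarrow> y \<in> B \<Longrightarrow> c x y = q) \<Longrightarrow>
          n \<le> card B + 1 \<Longrightarrow> \<not> has_F n W \<Longrightarrow> p \<noteq> q"
      have "p \<noteq> q" by (rule *(3)[of ?B]) (use cross c3 n4 noF in auto)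
      then show thesis using that *(1,2) by blast
    qed
    have "p \<in> K" using p(2) K(2) unfolding used_def by blast
    moreover have "M \<subseteq> K - {p, q}" using M qM p by blast
    then have "card M \<le> card (K - {p, q})" using K(1) by (intro card_mono) auto
    moreover have "card (K - {p, q}) = card K - 2"
      using \<open>p \<in> K\<close> qK p(3) K(1) by (subst card_Diff_subset) auto
    moreover have "card {p, q} \<le> card K" using \<open>p \<in> K\<close> qK K(1) by (intro card_mono) auto
    ultimately show ?thesis using c3 cW p(3) by simp
  qed
qed

section \<open>Partitions into parts of at most two vertices\<close>

text \<open>Let \<open>S\<close> and \<open>T\<close> be the neighbors of \<open>v\<close> in colors
  \<open>r\<close> and \<open>b\<close>. A vertex with two \<open>r\<close>-neighbors in
  \<open>S\<close> closes a four-cycle through \<open>v\<close>, so \<open>r\<close> is sparse there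
  and \<open>b\<close> takes over: two vertices of \<open>T\<close> would be center and opposite
  vertex of a copy in \<open>b\<close>, and if \<open>T\<close> has at most one vertex,
  \<open>b\<close> is nearly complete on \<open>S \<union> T\<close>. The size \<open>n + 3\<close>
  then gives \<open>S\<close> at least \<open>n + 1\<close> vertices, so that an opposite vertex
  inside \<open>S\<close> can be spared from the degree count.\<close>

lemma two_colored_quotient_has_F:
  assumes fin: "finite W" and m: "modular W E" and rb: "r \<noteq> b"
    and col: "\<And>x y. x \<in> W \<Longrightarrow> y \<in> W \<Longrightarrow> (x, y) \<notin> E \<Longrightarrow> c x y \<in> {r, b}"
    and cls: "\<And>x y z. (x, y) \<in> E \<Longrightarrow> (x, z) \<in> E \<Longrightarrow> x = y \<or> x = z \<or> y = z"
    and n: "3 \<le> n" "n + 3 \<le> card W" and v: "v \<in> W"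
    and deg: "n \<le> card {u \<in> W. (v, u) \<notin> E \<and> c v u = r}"
  shows "has_F n W"
proof (rule ccontr)
  assume noF: "\<not> has_F n W"
  have eq: "equiv W E" using m unfolding modular_def by blast
  have EV: "E \<subseteq> W \<times> W" using eq equiv_type by blast
  have Erefl: "(a, a) \<in> E" if "a \<in> W" for a using eq that by (meson equivE refl_onD)
  have Esym: "(b, a) \<in> E" if "(a, b) \<in> E" for a b using eq that by (meson equivE symE)
  define S where "S = {u \<in> W. (v, u) \<notin> E \<and> c v u = r}"
  define T where "T = {u \<in> W. (v, u) \<notin> E \<and> c v u = b}"
  have finS: "finite S" "finite T" using fin unfolding S_def T_def by auto
  have SW: "S \<subseteq> W" "v \<notin> S" "v \<notin> T" "T \<subseteq> W" "S \<inter> T = {}"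
    using v Erefl rb unfolding S_def T_def by auto
  have Sn: "n \<le> card S" using deg unfolding S_def .
  have Sv: "S \<subseteq> nbrs W r v" using SW unfolding nbrs_def S_def by auto
  have single: "u = v" if "(v, u) \<in> E" for u
  proof (rule ccontr)
    assume "u \<noteq> v"
    have "S \<subseteq> nbrs W r u"
    proof
      fix x assume x: "x \<in> S"
      then have "c v x = c u x" using modularD[OF m that Erefl] unfolding S_def by auto
      moreover have "x \<noteq> u" using x that unfolding S_def by auto
      ultimately show "x \<in> nbrs W r u" using x unfolding S_def nbrs_def by auto
    qed
    moreover have "u \<notin> S" "u \<in> W" using that EV unfolding S_def by auto
    ultimately have "has_F n W"
      by (intro has_FI[of W v u S r S]) (use fin v Sv Sn n \<open>u \<noteq> v\<close> in auto)
    then show False using noF by blast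
  qed
  have W: "W = insert v (S \<union> T)"
    using col[of v] single v unfolding S_def T_def by auto
  have cW: "card W = Suc (card S + card T)"
    unfolding W using finS SW by (simp add: card_Un_disjoint)
  have T_red: "card (nbrs W r w \<inter> S) \<le> 1" if "w \<in> T" for w
  proof (rule ccontr)
    assume "\<not> ?thesis"
    then have "has_F n W"
      by (intro has_FI[of W v w "nbrs W r w \<inter> S" r S]) (use fin v SW Sv Sn that in auto)
    then show False using noF by blast
  qed
  have T_blue: "S - nbrs W r t \<subseteq> nbrs W b t" if "t \<in> T" for t
  proof
    fix x assume x: "x \<in> S - nbrs W r t"
    have "(t, x) \<notin> E"
    proof
      assume "(t, x) \<in> E"
      then have "c v t = c v x" using modularD[OF m Erefl[OF v]] that unfolding T_def by blast
      then show False using x that rb unfolding S_def T_def by auto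
    qed
    then show "x \<in> nbrs W b t"
      using col[of t x] x that SW unfolding nbrs_def by auto
  qed
  have T1: "card T \<le> 1"
  proof (rule ccontr)
    assume "\<not> ?thesis"
    then have "2 \<le> card T" by simp
    then obtain t t' where t: "t \<in> T" "t' \<in> T" "t \<noteq> t'" by (rule card_ge_2E)
    let ?D = "insert v (S - nbrs W r t)"
    let ?C = "insert v (S - nbrs W r t - nbrs W r t')"
    have vt: "v \<in> nbrs W b t" "v \<in> nbrs W b t'"
      using t v SW sym unfolding nbrs_def T_def by auto
    have a: "card S \<le> card (S - nbrs W r t) + 1"
      using T_red[OF t(1)] card_le_Diff_plus_Int[OF finS(1), of "nbrs W r t"] by linarith
    have "card (nbrs W r t' \<inter> (S - nbrs W r t)) \<le> card (nbrs W r t' \<inter> S)"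
      using finS by (intro card_mono) auto
    then have "card (S - nbrs W r t) \<le> card (S - nbrs W r t - nbrs W r t') + 1"
      using T_red[OF t(2)] card_le_Diff_plus_Int[of "S - nbrs W r t" "nbrs W r t'"] finS by simp
    then have C: "2 \<le> card ?C" using a finS SW n Sn by simp
    have D: "n \<le> card ?D" using a finS SW Sn by simp
    have "has_F n W"
      by (rule has_FI[of W t t' ?C b ?D])
        (use fin t SW vt T_blue[OF t(1)] T_blue[OF t(2)] C D in auto)
    then show False using noF by blast
  qed
  have S_big: "n + 1 \<le> card S" using T1 cW n by linarith
  have S_red: "card (nbrs W r w \<inter> S) \<le> 1" if "w \<in> S" for w
  proof (rule ccontr)
    assume "\<not> ?thesis"
    moreover have "n \<le> card (S - {w})" using S_big that finS by simp
    ultimately have "has_F n W"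
      by (intro has_FI[of W v w "nbrs W r w \<inter> S" r "S - {w}"]) (use fin v SW Sv that in auto)
    then show False using noF by blast
  qed
  have T_eq: "t = t'" if "t \<in> T" "t' \<in> T" for t t'
    using T1 that card_le_Suc0_iff_eq[OF finS(2)] by simp
  define N where "N x = {y \<in> S \<union> T - {x}. c x y \<noteq> b}" for x
  have finN: "finite (N x)" for x unfolding N_def using finS by simp
  \<comment> \<open>Inside \<open>S\<close>, an edge not colored \<open>b\<close> has color
    \<open>r\<close> or joins two vertices of one class. If \<open>x\<close> has a classmate and an
    \<open>r\<close>-neighbor in \<open>S\<close>, modularity joins that neighbor to both in
    \<open>r\<close>, which again gives a vertex with two \<open>r\<close>-neighbors in
    \<open>S\<close>.\<close>
  have NS: "card (N x \<inter> S) \<le> 1" if x: "x \<in> S" for x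
  proof (rule ccontr)
    assume "\<not> ?thesis"
    then have "2 \<le> card (N x \<inter> S)" by simp
    then obtain y z where yz: "y \<in> N x \<inter> S" "z \<in> N x \<inter> S" "y \<noteq> z" by (rule card_ge_2E)
    then have d: "y \<in> W" "z \<in> W" "x \<noteq> y" "x \<noteq> z" "c x y \<noteq> b" "c x z \<noteq> b" "x \<in> W"
      using SW x unfolding N_def by auto
    have two: False if "u \<in> S" "p \<in> S" "q \<in> S" "u \<noteq> p" "u \<noteq> q" "p \<noteq> q" "c u p = r" "c u q = r" for u p q
    proof -
      have "card {p, q} \<le> card (nbrs W r u \<inter> S)"
        using that finS SW by (intro card_mono) (auto simp: nbrs_def)
      then show False using S_red[OF that(1)] that by simp
    qed
    consider "(x, y) \<notin> E" "(x, z) \<notin> E" | "(x, y) \<in> E" "(x, z) \<notin> E" | "(x, y) \<notin> E" "(x, z) \<in> E"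
      using cls[of x y z] yz d by auto
    then show False
    proof cases
      case 1
      then have "c x y = r" "c x z = r" using col d by blast+
      then show False using two[of x y z] x yz d by auto
    next
      case 2
      then have "c x z = r" using col d by blast
      moreover have "c x z = c y z" using modularD[OF m 2(1) Erefl 2(2)] d by auto
      ultimately show False using two[of z x y] x yz d sym by (metis IntD2)
    next
      case 3
      then have "c x y = r" using col d by blast
      moreover have "c x y = c z y" using modularD[OF m 3(2) Erefl 3(1)] d by auto
      ultimately show False using two[of y x z] x yz d sym by (metis IntD2)
    qed
  qed
  have NT: "card (N t) \<le> 1" if t: "t \<in> T" for t
  proof -
    have "T = {t}" using T_eq t by blast
    then have "N t \<subseteq> nbrs W r t \<inter> S"
      using T_blue[OF t] unfolding N_def nbrs_def by auto
    then have "card (N t) \<le> card (nbrs W r t \<inter> S)" using finS by (intro card_mono) auto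
    then show ?thesis using T_red[OF t] by linarith
  qed
  have N_split: "card (N x) \<le> card (N x \<inter> S) + card (N x \<inter> T)" for x
  proof -
    have "N x = (N x \<inter> S) \<union> (N x \<inter> T)" unfolding N_def by auto
    then show ?thesis using card_Un_le by metis
  qed
  \<comment> \<open>The only possible vertex of \<open>T\<close> has at most one partner not joined
    to it in \<open>b\<close>. Only at this partner can the bounds for \<open>S\<close> and
    \<open>T\<close> add up to two.\<close>
  obtain x1 where x1: "\<And>x. x \<in> S \<Longrightarrow> x \<noteq> x1 \<Longrightarrow> N x \<inter> T = {}"
  proof (cases "\<exists>x1\<in>S. \<exists>t\<in>T. c x1 t \<noteq> b")
    case True
    then obtain x1 t where x1: "x1 \<in> S" "t \<in> T" "c x1 t \<noteq> b" by blast
    have "N x \<inter> T = {}" if "x \<in> S" "x \<noteq> x1" for x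
    proof (rule ccontr)
      assume "\<not> ?thesis"
      then obtain t' where t': "t' \<in> T" "c x t' \<noteq> b" unfolding N_def by auto
      have "t' = t" using T_eq t' x1 by blast
      then have "{x, x1} \<subseteq> N t" using t' x1 that sym SW unfolding N_def by auto
      then have "card {x, x1} \<le> card (N t)" using finN by (intro card_mono) auto
      then show False using NT[OF x1(2)] that by simp
    qed
    then show thesis using that by blast
  next
    case False
    then show thesis using that[of v] unfolding N_def by auto
  qed
  have "has_F n W"
  proof (rule nearly_complete_has_F[OF fin, of "S \<union> T" n x1 b])
    show "S \<union> T \<subseteq> W" using SW by auto
    show "n + 2 \<le> card (S \<union> T)" using cW n finS SW by (simp add: card_Un_disjoint)
    show "card {y \<in> S \<union> T - {x}. c x y \<noteq> b} \<le> 1" if "x \<in> S \<union> T" "x \<noteq> x1" for x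
      using that NT[of x] NS[of x] x1[of x] N_split[of x] unfolding N_def[symmetric] by fastforce
    show "card {y \<in> S \<union> T - {x}. c x y \<noteq> b} \<le> 2" if "x \<in> S \<union> T" for x
    proof -
      have "card (N x \<inter> T) \<le> card T" using finS by (intro card_mono) auto
      then show ?thesis
        using that NT[of x] NS[of x] N_split[of x] T1 unfolding N_def[symmetric] by fastforce
    qed
  qed (use n in auto)
  then show False using noF by blast
qed

lemma modular_restrict:
  assumes "modular V E" "U \<subseteq> V"
  shows "modular U (E \<inter> U \<times> U)"
proof -
  have "equiv V E" using assms unfolding modular_def by blast
  then have "equiv U (E \<inter> U \<times> U)"
    using assms(2) unfolding equiv_def refl_on_def sym_on_def trans_on_def by blast
  then show ?thesis using assms unfolding modular_def by blast
qed

lemma card_class_plus_degrees: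
  assumes fin: "finite W" and m: "modular W E" and rb: "r \<noteq> b" and v: "v \<in> W"
    and col: "\<And>x y. x \<in> W \<Longrightarrow> y \<in> W \<Longrightarrow> (x, y) \<notin> E \<Longrightarrow> c x y \<in> {r, b}"
  shows "card W = card (E `` {v}) + card {u \<in> W. (v, u) \<notin> E \<and> c v u = r} +
    card {u \<in> W. (v, u) \<notin> E \<and> c v u = b}"
proof -
  let ?R = "{u \<in> W. (v, u) \<notin> E \<and> c v u = r}" and ?B = "{u \<in> W. (v, u) \<notin> E \<and> c v u = b}"
  have "E \<subseteq> W \<times> W" using m equiv_type unfolding modular_def by blast
  then have sub: "E `` {v} \<subseteq> W" by auto
  then have finE: "finite (E `` {v})" using fin finite_subset by blast
  have "W = (E `` {v} \<union> ?R) \<union> ?B" using col[OF v] sub by auto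
  then have "card W = card ((E `` {v} \<union> ?R) \<union> ?B)" by simp
  also have "\<dots> = card (E `` {v} \<union> ?R) + card ?B"
    by (rule card_Un_disjoint) (use fin finE rb in auto)
  also have "card (E `` {v} \<union> ?R) = card (E `` {v}) + card ?R"
    by (rule card_Un_disjoint) (use fin finE in auto)
  finally show ?thesis by simp
qed

text \<open>If all degrees were at most 3, then coloring the edges inside the parts suitably would make the
  color \<open>r\<close> a 3-regular graph on seven vertices.\<close>

lemma seven_vertices_has_F:
  assumes fin: "finite W" and m: "modular W E" and rb: "r \<noteq> b"
    and col: "\<And>x y. x \<in> W \<Longrightarrow> y \<in> W \<Longrightarrow> (x, y) \<notin> E \<Longrightarrow> c x y \<in> {r, b}"
    and cls: "\<And>x y z. (x, y) \<in> E \<Longrightarrow> (x, z) \<in> E \<Longrightarrow> x = y \<or> x = z \<or> y = z"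
    and W7: "card W = 7"
  shows "has_F 4 W"
proof (rule ccontr)
  assume noF: "\<not> has_F 4 W"
  have eq: "equiv W E" using m unfolding modular_def by blast
  have EV: "E \<subseteq> W \<times> W" using eq equiv_type by blast
  have Erefl: "(a, a) \<in> E" if "a \<in> W" for a using eq that by (meson equivE refl_onD)
  have Esym: "(b, a) \<in> E" if "(a, b) \<in> E" for a b using eq that by (meson equivE symE)
  have Etrans: "(a, d) \<in> E" if "(a, b) \<in> E" "(b, d) \<in> E" for a b d using eq that by (meson equivE transE)
  define deg where "deg q v = card {u \<in> W. (v, u) \<notin> E \<and> c v u = q}" for q v
  have "deg r v \<le> 3" if "v \<in> W" for v
    using two_colored_quotient_has_F[OF fin m rb col cls _ _ that, of 4] noF W7
    unfolding deg_def by fastforce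
  moreover have "deg b v \<le> 3" if "v \<in> W" for v
    using two_colored_quotient_has_F[OF fin m rb[symmetric] _ cls _ _ that, of 4] col noF W7
    unfolding deg_def by fastforce
  moreover have cl2: "card (E `` {v}) \<le> 2" for v
  proof (rule ccontr)
    assume "\<not> ?thesis"
    then have "2 \<le> card (E `` {v} - {v})" by (auto simp: card_Diff_singleton_if)
    then obtain y z where "y \<in> E `` {v} - {v}" "z \<in> E `` {v} - {v}" "y \<noteq> z" by (rule card_ge_2E)
    then show False using cls[of v y z] by auto
  qed
  moreover have total: "7 = card (E `` {v}) + deg r v + deg b v" if "v \<in> W" for v
    using card_class_plus_degrees[OF fin m rb that col] W7 unfolding deg_def by simp
  ultimately have deg_r: "deg r v \<le> 3" "3 \<le> deg r v + card (E `` {v} - {v})" if "v \<in> W" for v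
  proof -
    have "finite (E `` {v})" using EV fin by (meson finite_SigmaI finite_subset finite_Image)
    then have "card (E `` {v} - {v}) + 1 = card (E `` {v})"
      using Erefl[OF that] by (metis ImageI Suc_eq_plus1 card_Suc_Diff1 singletonI)
    then show "deg r v \<le> 3" "3 \<le> deg r v + card (E `` {v} - {v})"
      using \<open>\<And>v. v \<in> W \<Longrightarrow> deg r v \<le> 3\<close> \<open>\<And>v. v \<in> W \<Longrightarrow> deg b v \<le> 3\<close> total that by fastforce+
  qed
  have cl1: "card (E `` {v} - {v}) \<le> 1" if "v \<in> W" for v
  proof -
    have "finite (E `` {v})" using EV fin by (meson finite_SigmaI finite_subset finite_Image)
    then show ?thesis using cl2[of v] Erefl[OF that] by (simp add: card_Diff_singleton_if)
  qed
  have deg_twin: "deg r x = deg r y" if "(x, y) \<in> E" for x y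
  proof -
    have "{u \<in> W. (x, u) \<notin> E \<and> c x u = r} = {u \<in> W. (y, u) \<notin> E \<and> c y u = r}"
      using modularD[OF m that Erefl] modularD[OF m Esym[OF that] Erefl] Esym Etrans that by blast
    then show ?thesis unfolding deg_def by simp
  qed
  \<comment> \<open>The degrees in \<open>r\<close> and \<open>b\<close> are at most 3 and add up
    with the class size to 7. So a singleton has degree 3 in \<open>r\<close>, and the members of a
    pair have a common degree 2 or 3. Adding the edge inside the pair exactly when it is 2 makes
    \<open>R\<close> 3-regular.\<close>
  define R where "R x y \<longleftrightarrow> x \<noteq> y \<and> ((x, y) \<notin> E \<and> c x y = r \<or> (x, y) \<in> E \<and> deg r x = 2)" for x y
  have "R y x" if "R x y" for x y
    using that deg_twin Esym sym unfolding R_def by metis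
  moreover have "\<not> R x x" for x unfolding R_def by simp
  ultimately have even: "even (card {(x, y) \<in> W \<times> W. R x y})"
    by (rule even_card_symmetric[OF fin])
  have "card {y \<in> W. R x y} = 3" if x: "x \<in> W" for x
  proof (cases "deg r x = 2")
    case True
    have "{y \<in> W. R x y} = {u \<in> W. (x, u) \<notin> E \<and> c x u = r} \<union> (E `` {x} - {x})"
      using True EV Erefl[OF x] unfolding R_def by auto
    moreover have "card ({u \<in> W. (x, u) \<notin> E \<and> c x u = r} \<union> (E `` {x} - {x})) =
        deg r x + card (E `` {x} - {x})"
      unfolding deg_def
    proof (rule card_Un_disjoint)
      show "finite (E `` {x} - {x})" using EV fin by (meson finite_Diff finite_SigmaI finite_subset finite_Image)
    qed (use fin in auto)
    ultimately show ?thesis using deg_r[OF x] cl1[OF x] True by simp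
  next
    case False
    then have "{y \<in> W. R x y} = {u \<in> W. (x, u) \<notin> E \<and> c x u = r}"
      using Erefl[OF x] unfolding R_def by auto
    then show ?thesis using deg_r[OF x] cl1[OF x] False unfolding deg_def by simp
  qed
  moreover have "{(x, y) \<in> W \<times> W. R x y} = (SIGMA x:W. {y \<in> W. R x y})" by auto
  then have "card {(x, y) \<in> W \<times> W. R x y} = (\<Sum>x\<in>W. card {y \<in> W. R x y})"
    using fin by (simp add: card_SigmaI)
  ultimately have "card {(x, y) \<in> W \<times> W. R x y} = 21" using W7 by simp
  then show False using even by simp
qed

section \<open>Partitions without a monochromatic cut\<close>

text \<open>Neither \<open>r\<close> nor \<open>b\<close> is a matching, which keeps two colors out
  of \<open>M\<close>. The bound \<open>3 * n - 4\<close> is \<open>n - 2\<close> for a largest part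
  plus \<open>n - 1\<close> for each of its two color neighborhoods.\<close>

lemma no_cut_bound:
  assumes fin: "finite W" and g: "gallai W" and noF: "\<not> has_F n W" and n: "3 \<le> n"
    and nocut: "\<And>A q. \<not> mono_cut W A q" and W2: "2 \<le> card W"
    and K: "finite K" "\<And>x y. x \<in> W \<Longrightarrow> y \<in> W \<Longrightarrow> x \<noteq> y \<Longrightarrow> c x y \<in> K"
    and M: "M \<subseteq> K" "\<And>p. p \<in> M \<Longrightarrow> matching p W"
  shows "card M + 2 \<le> card K \<and> card W + 4 \<le> 3 * n \<and> (n = 4 \<longrightarrow> card W \<le> 6) \<and>
    (n = 5 \<longrightarrow> card W + card M \<le> card K + 8)"
proof -
  obtain E r b where rb: "r \<noteq> b" and m: "modular W E"
    and ne: "E \<noteq> W \<times> W"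
    and col: "\<And>x y. x \<in> W \<Longrightarrow> y \<in> W \<Longrightarrow> (x, y) \<notin> E \<Longrightarrow> c x y \<in> {r, b}"
    and cross: "\<And>q A. q \<in> {r, b} \<Longrightarrow> saturated E A \<Longrightarrow>
       A \<subseteq> W \<Longrightarrow> A \<noteq> {} \<Longrightarrow> A \<noteq> W \<Longrightarrow> \<exists>x\<in>A. \<exists>y\<in>W - A. c x y = q"
    by (rule gallai_decomposition[OF fin W2 g nocut]) (rule that)
  have eq: "equiv W E" using m unfolding modular_def by blast
  have EV: "E \<subseteq> W \<times> W" using eq equiv_type by blast
  have Erefl: "(a, a) \<in> E" if "a \<in> W" for a using eq that by (meson equivE refl_onD)
  have Esym: "(b, a) \<in> E" if "(a, b) \<in> E" for a b using eq that by (meson equivE symE)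
  have Etrans: "(a, d) \<in> E" if "(a, b) \<in> E" "(b, d) \<in> E" for a b d using eq that by (meson equivE transE)
  have sat: "saturated E (E `` {x})" for x
    unfolding saturated_def using Etrans by blast
  have cl_ne: "E `` {x} \<noteq> W" if "x \<in> W" for x
  proof
    assume *: "E `` {x} = W"
    have "(u, v) \<in> E" if "u \<in> W" "v \<in> W" for u v
    proof -
      have "(x, u) \<in> E" "(x, v) \<in> E" using * that by auto
      then show ?thesis using Esym Etrans by blast
    qed
    then show False using ne EV by auto
  qed
  have cl_sub: "E `` {x} \<subseteq> W" for x using EV by auto
  have finE: "finite (E `` {x})" for x using cl_sub fin finite_subset by blast
  have cross_at: "\<exists>u\<in>W. (x, u) \<notin> E \<and> c x u = q" if x: "x \<in> W" and q: "q \<in> {r, b}" for x q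
  proof -
    obtain a u where a: "(x, a) \<in> E" "u \<in> W" "(x, u) \<notin> E" "c a u = q"
      using cross[OF q sat cl_sub _ cl_ne[OF x]] Erefl[OF x] by blast
    have "c x u = c a u" using modularD[OF m a(1) Erefl[OF a(2)] a(3)] .
    then show ?thesis using a by auto
  qed
  \<comment> \<open>Two classes joined in \<open>q\<close> cannot make up all of \<open>W\<close>,
    as they would form a cut. So \<open>q\<close> leads out of their union, and by modularity
    \<open>a\<close> or \<open>u\<close> has a second neighbor in color \<open>q\<close>.\<close>
  have nonmatching: "\<not> matching q W \<and> q \<in> K" if q: "q \<in> {r, b}" for q
  proof -
    obtain a where "a \<in> W" using W2 by (rule card_ge_2E)
    then obtain u where a: "a \<in> W" "u \<in> W" "(a, u) \<notin> E" "c a u = q" using cross_at q by blast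
    have au: "a \<noteq> u" using a Erefl by auto
    let ?A = "E `` {a} \<union> E `` {u}"
    have "saturated E ?A" using sat unfolding saturated_def by blast
    moreover have "?A \<noteq> W"
    proof
      assume A: "?A = W"
      have "mono_cut W (E `` {a}) q"
        unfolding mono_cut_def
      proof (intro conjI ballI)
        fix x y assume "x \<in> E `` {a}" "y \<in> W - E `` {a}"
        then have "(a, x) \<in> E" "(u, y) \<in> E" using A by auto
        then show "c x y = q" using modularD[OF m _ _ a(3)] a(4) by metis
      qed (use cl_sub cl_ne[OF a(1)] Erefl[OF a(1)] in auto)
      then show False using nocut by blast
    qed
    moreover have "?A \<subseteq> W" "?A \<noteq> {}" using cl_sub Erefl[OF a(1)] by auto
    ultimately obtain x w where x: "x \<in> ?A" "w \<in> W - ?A" "c x w = q"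
      using cross[OF q] by metis
    have aw: "(a, w) \<notin> E" "(u, w) \<notin> E" "w \<in> W" "a \<noteq> w" "u \<noteq> w" using x(2) Erefl a by auto
    have "\<not> matching q W"
    proof (cases "(a, x) \<in> E")
      case True
      then have "c a w = q" using modularD[OF m True Erefl[OF aw(3)] aw(1)] x by simp
      then show ?thesis using not_matchingI[of W a u w q] fin a aw au by blast
    next
      case False
      then have ux: "(u, x) \<in> E" using x by auto
      then have "c u w = q" using modularD[OF m ux Erefl[OF aw(3)] aw(2)] x by simp
      then show ?thesis using not_matchingI[of W u a w q] fin a aw au sym by metis
    qed
    moreover have "q \<in> K" using K(2)[of a u] a au by simp
    ultimately show ?thesis by simp
  qed
  have rbM: "r \<notin> M" "b \<notin> M" and rbK: "r \<in> K" "b \<in> K" using nonmatching M by blast+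
  have "card (K - {r, b}) = card K - 2" using rb rbK K(1) by (subst card_Diff_subset) auto
  moreover have "card {r, b} \<le> card K" using rbK K(1) by (intro card_mono) auto
  moreover have "card M \<le> card (K - {r, b})" using M rbM K(1) by (intro card_mono) auto
  ultimately have cM: "card M + 2 \<le> card K" using rb by simp
  have "\<exists>x. x \<in> W \<and> (\<forall>y. y \<in> W \<longrightarrow> card (E `` {y}) \<le> card (E `` {x}))"
  proof -
    obtain a where "a \<in> W" using W2 by (rule card_ge_2E)
    moreover have "\<forall>y. y \<in> W \<longrightarrow> card (E `` {y}) < Suc (card W)"
      using cl_sub fin by (meson card_mono le_imp_less_Suc)
    ultimately show ?thesis by (rule ex_has_greatest_nat)
  qed
  then obtain x where x: "x \<in> W" and maxcl: "\<And>y. y \<in> W \<Longrightarrow> card (E `` {y}) \<le> card (E `` {x})"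
    by blast
  define P where "P = E `` {x}"
  define Q where "Q q = {u \<in> W. (x, u) \<notin> E \<and> c x u = q}" for q
  have PW: "P \<subseteq> W" "finite P" using cl_sub finE unfolding P_def by auto
  have QW: "Q q \<subseteq> W" "finite (Q q)" "P \<inter> Q q = {}" for q using fin unfolding Q_def P_def by auto
  have cW: "card W = card P + card (Q r) + card (Q b)"
    using card_class_plus_degrees[OF fin m rb x col] unfolding P_def Q_def .
  have Wun: "W = P \<union> Q r \<union> Q b" using col[OF x] PW unfolding P_def Q_def by auto
  have PQ: "c y u = q" if "y \<in> P" "u \<in> Q q" for y u q
    using modularD[OF m _ Erefl, of x y u] that unfolding P_def Q_def by auto
  have Qne: "Q q \<noteq> {}" if "q \<in> {r, b}" for q
    using cross_at[OF x that] unfolding Q_def by auto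
  have Q1: "1 \<le> card (Q q)" if "q \<in> {r, b}" for q
    using Qne[OF that] QW(2) by (metis One_nat_def Suc_leI card_gt_0_iff)
  have Qsmall: "card (Q q) < n" if "2 \<le> card P" for q
  proof (rule ccontr)
    assume "\<not> ?thesis"
    then have "has_F n W"
      by (intro biclique_has_F[of W P "Q q" q n]) (use fin PW QW PQ that n in auto)
    then show False using noF by blast
  qed
  \<comment> \<open>If \<open>P\<close> has \<open>n - 1\<close> vertices, a \<open>q\<close>-edge
    from \<open>Q q\<close> to the other neighborhood is a forbidden pendant edge as soon as
    \<open>Q q\<close> has two vertices. Two neighborhoods of size at least 2 would thus impose
    different colors on the edges between them. If one is a single vertex, some such vertex is
    joined to everything else in one color, which is a cut.\<close>
  have Psmall: "card P + 2 \<le> n"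
  proof (rule ccontr)
    assume "\<not> ?thesis"
    then have Pn: "n \<le> card P + 1" by simp
    have QQ: "c u u' = q'" if q: "q \<in> {r, b}" "q' \<in> {r, b}" "q \<noteq> q'" "2 \<le> card (Q q)"
      and u: "u \<in> Q q" "u' \<in> Q q'" for q q' u u'
    proof (rule ccontr)
      assume "c u u' \<noteq> q'"
      have uW: "u \<in> W" "u' \<in> W" "u \<notin> P" "u' \<notin> P" using u unfolding Q_def P_def by auto
      have "(u, u') \<notin> E"
      proof
        assume "(u, u') \<in> E"
        then have "c x u = c x u'" using modularD[OF m Erefl[OF x]] u unfolding Q_def by blast
        then show False using u q unfolding Q_def by auto
      qed
      then have cu: "c u u' = q" using col[OF uW(1,2)] \<open>c u u' \<noteq> q'\<close> q by auto
      have "1 \<le> card (Q q - {u})" using q(4) u QW(2) by simp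
      then obtain w where w: "w \<in> Q q" "w \<noteq> u" by (metis Diff_iff all_not_in_conv card.empty insertI1 not_one_le_zero)
      have "u' \<notin> Q q" using u q unfolding Q_def by auto
      moreover have "Q q \<inter> P = {}" using QW(3)[of q] by blast
      moreover have "c y z = q" if "y \<in> Q q" "z \<in> P" for y z
        using PQ[OF that(2,1)] sym by simp
      moreover have "u' \<noteq> u" using \<open>u' \<notin> Q q\<close> u by blast
      ultimately have "has_F n W"
        using biclique_pendant_has_F[OF fin QW(1)[of q] PW(1) _ _ Pn n u(1) w(1) _ uW(2), of q] w uW cu
        by blast
      then show False using noF by blast
    qed
    have cut1: False if q: "{q, q'} = {r, b}" and s: "card (Q q) = 1"
      and all: "\<And>u u'. u \<in> Q q \<Longrightarrow> u' \<in> Q q' \<Longrightarrow> c u u' = q" for q q'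
    proof -
      obtain a where a: "Q q = {a}" using s by (auto simp: card_1_singleton_iff)
      have "mono_cut W {a} q"
        unfolding mono_cut_def
      proof (intro conjI ballI)
        show "{a} \<subseteq> W" using a QW by blast
        show "{a} \<noteq> W" using W2 by auto
        fix u v assume uv: "u \<in> {a}" "v \<in> W - {a}"
        then have "v \<in> P \<or> v \<in> Q q'" using Wun a q by (auto simp: doubleton_eq_iff)
        then show "c u v = q" using PQ[of v a q] all[of a v] a uv sym[of a v] by auto
      qed auto
      then show False using nocut by blast
    qed
    have qs: "card (Q q) = 1 \<or> 2 \<le> card (Q q)" if "q \<in> {r, b}" for q
      using Q1[OF that] by linarith
    show False
    proof (cases "2 \<le> card (Q r)")
      case True
      have all: "c u u' = b" if "u \<in> Q r" "u' \<in> Q b" for u u'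
        using QQ[of r b] True that rb by blast
      show False
      proof (cases "2 \<le> card (Q b)")
        case True
        obtain u where u: "u \<in> Q r" using Qne[of r] by auto
        obtain u' where u': "u' \<in> Q b" using Qne[of b] by auto
        have "c u' u = r" using QQ[of b r u' u] True u u' rb by auto
        then show False using all[OF u u'] sym rb by metis
      next
        case False
        then have "card (Q b) = 1" using qs[of b] by auto
        then show False using cut1[of b r] all sym by (metis insert_commute)
      qed
    next
      case False
      then have r1: "card (Q r) = 1" using qs[of r] by auto
      show False
      proof (cases "2 \<le> card (Q b)")
        case True
        have "c u u' = r" if "u \<in> Q r" "u' \<in> Q b" for u u'
          using QQ[of b r u' u] True that rb sym by (metis insertCI)
        then show False using cut1[of r b] r1 by blast
      next
        case False
        then have b1: "card (Q b) = 1" using qs[of b] by auto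
        obtain u where u: "Q r = {u}" using r1 by (auto simp: card_1_singleton_iff)
        obtain u' where u': "Q b = {u'}" using b1 by (auto simp: card_1_singleton_iff)
        have "(u, u') \<notin> E"
        proof
          assume "(u, u') \<in> E"
          moreover have "u \<in> Q r" "u' \<in> Q b" using u u' by auto
          ultimately have "c x u = c x u'" "c x u = r" "c x u' = b"
            using modularD[OF m Erefl[OF x]] unfolding Q_def by blast+
          then show False using rb by simp
        qed
        moreover have "u \<in> W" "u' \<in> W" using u u' QW by blast+
        ultimately have "c u u' = r \<or> c u u' = b" using col by blast
        then show False
          using cut1[of r b] cut1[of b r] r1 b1 u u' sym by (metis insert_commute singletonD)
      qed
    qed
  qed
  \<comment> \<open>With singleton parts, \<open>1 + card (Q r) + card (Q b)\<close> is at least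
    \<open>2 * n\<close> only if one of the two degrees reaches \<open>n\<close>.\<close>
  have small_classes: "card W < 2 * n" if P1: "card P \<le> 1"
  proof (rule ccontr)
    assume "\<not> ?thesis"
    then have big: "2 * n \<le> card W" by simp
    have "y = z" if "(y, z) \<in> E" for y z
    proof (rule ccontr)
      assume "y \<noteq> z"
      have y: "y \<in> W" "y \<in> E `` {y}" "z \<in> E `` {y}" using that EV Erefl by auto
      then have "card {y, z} \<le> card (E `` {y})" using finE by (intro card_mono) auto
      then show False using maxcl[OF y(1)] P1 \<open>y \<noteq> z\<close> unfolding P_def by simp
    qed
    then have cls: "u = y \<or> u = z \<or> y = z" if "(u, y) \<in> E" "(u, z) \<in> E" for u y z
      using that by blast
    have "n \<le> card (Q r) \<or> n \<le> card (Q b)" using cW P1 big by linarith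
    then have "has_F n W"
    proof
      assume "n \<le> card (Q r)"
      then show ?thesis
        using big n two_colored_quotient_has_F[OF fin m rb col cls n _ x] unfolding Q_def by simp
    next
      assume "n \<le> card (Q b)"
      moreover have "c u v \<in> {b, r}" if "u \<in> W" "v \<in> W" "(u, v) \<notin> E" for u v
        using col that by blast
      ultimately show ?thesis
        using big n two_colored_quotient_has_F[OF fin m rb[symmetric] _ cls n _ x] unfolding Q_def
        by simp
    qed
    then show False using noF by blast
  qed
  have bound: "card W + 4 \<le> 3 * n"
  proof (cases "card P \<le> 1")
    case True
    then show ?thesis using small_classes n by linarith
  next
    case False
    then show ?thesis using Qsmall[of r] Qsmall[of b] cW Psmall by linarith
  qed
  moreover have "card W \<le> 6" if n4: "n = 4"
  proof (rule ccontr)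
    assume "\<not> ?thesis"
    then have "7 \<le> card W" by simp
    then obtain U where U: "U \<subseteq> W" "card U = 7" by (meson obtain_subset_with_card_n)
    have finU: "finite U" using U fin finite_subset by blast
    have cls: "u = y \<or> u = z \<or> y = z" if "(u, y) \<in> E" "(u, z) \<in> E" for u y z
    proof (rule ccontr)
      assume d: "\<not> ?thesis"
      have u: "u \<in> W" "u \<in> E `` {u}" using that EV Erefl by auto
      then have "card {u, y, z} \<le> card (E `` {u})" using that finE by (intro card_mono) auto
      moreover have "card {u, y, z} = 3" using d by auto
      ultimately show False using maxcl[OF u(1)] Psmall n4 unfolding P_def by simp
    qed
    have "has_F 4 U"
      by (rule seven_vertices_has_F[OF finU modular_restrict[OF m U(1)] rb _ _ U(2)])
        (use col cls U in blast)+
    then show False using has_F_mono[OF _ U(1) fin] noF n4 by blast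
  qed
  moreover have "card W + card M \<le> card K + 8" if n5: "n = 5"
  proof (cases "card W \<le> 10")
    case True
    then show ?thesis using cM by simp
  next
    case False
    then have P2: "2 \<le> card P" using small_classes n5 by linarith
    \<comment> \<open>Eleven vertices are possible only as 3 + 4 + 4. Both \<open>r\<close> and
      \<open>b\<close> join \<open>P\<close> to \<open>n - 1\<close> vertices, so the repeated color
      inside \<open>P\<close> is a third color outside \<open>M\<close>.\<close>
    then have c: "card P = 3" "card (Q r) = 4" "card (Q b) = 4"
      using Qsmall[of r] Qsmall[of b] cW Psmall n5 False by linarith+
    obtain p where p: "\<not> matching p W" "used p W" "p \<noteq> r" "p \<noteq> b"
    proof (rule mono_cherry_in_triangle[OF fin g PW(1) c(1) n])
      fix p assume *: "\<not> matching p W" "used p W"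
        "\<And>B q. B \<subseteq> W \<Longrightarrow> P \<inter> B = {} \<Longrightarrow> (\<And>x y. x \<in> P \<Longrightarrow> y \<in> B \<Longrightarrow> c x y = q) \<Longrightarrow>
          n \<le> card B + 1 \<Longrightarrow> \<not> has_F n W \<Longrightarrow> p \<noteq> q"
      have "p \<noteq> r" by (rule *(3)[of "Q r"]) (use QW PQ c n5 noF in auto)
      moreover have "p \<noteq> b" by (rule *(3)[of "Q b"]) (use QW PQ c n5 noF in auto)
      ultimately show thesis using that *(1,2) by blast
    qed
    have pK: "p \<in> K" using p(2) K(2) unfolding used_def by blast
    have "card M \<le> card (K - {p, r, b})"
      using M rbM p(1) K(1) by (intro card_mono) auto
    moreover have "card (K - {p, r, b}) = card K - 3"
      using pK rbK p(3,4) rb K(1) by (subst card_Diff_subset) auto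
    moreover have "card {p, r, b} \<le> card K" using pK rbK K(1) by (intro card_mono) auto
    ultimately show ?thesis using c cW p(3,4) rb by simp
  qed
  ultimately show ?thesis using cM by simp
qed

section \<open>The upper bounds combined\<close>

lemma gallai_F_bound:
  assumes fin: "finite V" and g: "gallai V" and noF: "\<not> has_F n V" and n: "3 \<le> n"
    and K: "finite K" "\<And>x y. x \<in> V \<Longrightarrow> y \<in> V \<Longrightarrow> x \<noteq> y \<Longrightarrow> c x y \<in> K"
  shows "n \<le> 4 \<Longrightarrow> card V \<le> card K + n"
    and "n = 5 \<Longrightarrow> card V \<le> card K + 8"
    and "3 \<le> card K \<Longrightarrow> card V \<le> card K * (n - 1) + 1"
proof -
  obtain W M where WV: "W \<subseteq> V" and MK: "M \<subseteq> K" and cV: "card V = card W + card M"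
    and mat: "\<And>q. q \<in> M \<Longrightarrow> matching q W"
    and dom: "card W \<le> n + 1 \<or> (\<forall>v\<in>W. \<forall>q. \<exists>u\<in>W - {v}. c v u \<noteq> q)"
    using strip_dominating[OF fin K(1) noF K(2)] n by auto
  have finW: "finite W" and gW: "gallai W" and noFW: "\<not> has_F n W"
    using WV fin finite_subset gallai_subset[OF g] has_F_mono[of n W V] noF by auto
  have KW: "\<And>x y. x \<in> W \<Longrightarrow> y \<in> W \<Longrightarrow> x \<noteq> y \<Longrightarrow> c x y \<in> K" using K(2) WV by blast
  have MleK: "card M \<le> card K" using MK K(1) by (rule card_mono[rotated])
  have small_bound: "card V \<le> card K + n" if "card W \<le> n + 1"
  proof (cases "card W \<le> 2")
    case True
    then show ?thesis using cV MleK n by linarith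
  next
    case False
    then have "3 \<le> card W" by simp
    then obtain A where A: "A \<subseteq> W" "card A = 3" by (meson obtain_subset_with_card_n)
    obtain p where p: "\<not> matching p W" "used p W"
      by (rule mono_cherry_in_triangle[OF finW gW A n])
    have "p \<in> K" using p(2) KW unfolding used_def by blast
    moreover have "p \<notin> M" using p(1) mat by blast
    ultimately have "M \<subset> K" using MK by blast
    then have "card M < card K" using K(1) by (simp add: psubset_card_mono)
    then show ?thesis using cV that by linarith
  qed
  have cut_bound: "card V + 3 \<le> 2 * n + card K \<and> (n = 4 \<longrightarrow> card V \<le> card K + 4)"
    if big: "n + 2 \<le> card W" and cut: "mono_cut W A q" for A q
  proof -
    have nodom: "\<exists>u\<in>W - {v}. c v u \<noteq> q" if "v \<in> W" for v
      using dom big that by auto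
    have AW: "A \<subseteq> W" "A \<noteq> {}" "A \<noteq> W" "\<And>x y. x \<in> A \<Longrightarrow> y \<in> W - A \<Longrightarrow> c x y = q"
      using cut unfolding mono_cut_def by auto
    \<comment> \<open>A one-vertex side would be a vertex joined to all others in one color, and
      these have been stripped off.\<close>
    have not1: "2 \<le> card B" if B: "B \<subseteq> W" "B \<noteq> {}" "\<And>x y. x \<in> B \<Longrightarrow> y \<in> W - B \<Longrightarrow> c x y = q" for B
    proof (rule ccontr)
      assume "\<not> ?thesis"
      moreover have "card B \<noteq> 0" using B(2) finite_subset[OF B(1) finW] by simp
      ultimately have "card B = 1" by linarith
      then obtain a where "B = {a}" by (auto simp: card_1_singleton_iff)
      then show False using nodom[of a] B by auto
    qed
    have A2: "2 \<le> card A" using not1[of A] AW by blast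
    have B2: "2 \<le> card (W - A)"
    proof (rule not1)
      fix x y assume "x \<in> W - A" "y \<in> W - (W - A)"
      then show "c x y = q" using AW(4)[of y x] sym[of x y] by auto
    qed (use AW in auto)
    show ?thesis
      using mono_cut_bound[OF finW gW noFW n cut A2 B2 K(1) KW MK mat] cV by simp
  qed
  have nocut_bound: "card M + 2 \<le> card K \<and> card W + 4 \<le> 3 * n \<and> (n = 4 \<longrightarrow> card W \<le> 6) \<and>
    (n = 5 \<longrightarrow> card W + card M \<le> card K + 8)"
    if "n + 2 \<le> card W" "\<And>A q. \<not> mono_cut W A q"
    using no_cut_bound[OF finW gW noFW n that(2) _ K(1) KW MK mat] that(1) by simp
  consider (small) "card W \<le> n + 1" | (cut) A q where "n + 2 \<le> card W" "mono_cut W A q"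
    | (nocut) "n + 2 \<le> card W" "\<And>A q. \<not> mono_cut W A q"
    by fastforce
  then have all: "(n \<le> 4 \<longrightarrow> card V \<le> card K + n) \<and> (n = 5 \<longrightarrow> card V \<le> card K + 8) \<and>
    card V + 5 \<le> 3 * n + card K"
  proof cases
    case small
    then show ?thesis using small_bound n by auto
  next
    case cut
    then show ?thesis using cut_bound[OF cut] n by auto
  next
    case nocut
    then show ?thesis using nocut_bound[OF nocut] n cV by auto
  qed
  then show "n \<le> 4 \<Longrightarrow> card V \<le> card K + n" "n = 5 \<Longrightarrow> card V \<le> card K + 8" by auto
  show "card V \<le> card K * (n - 1) + 1" if k: "3 \<le> card K"
  proof -
    \<comment> \<open>With \<open>k = card K\<close>, the claimed bound exceeds
      \<open>3 * n + k - 5\<close> by \<open>(k - 3) * (n - 2)\<close>. Writing \<open>k\<close> and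
      \<open>n\<close> as shifts of 3 turns this into \<open>j * (l + 1)\<close> and removes the
      truncated subtraction.\<close>
    obtain j where j: "card K = 3 + j" using k le_Suc_ex by blast
    obtain l where l: "n = 3 + l" using n le_Suc_ex by blast
    show ?thesis using all unfolding j l by (simp add: algebra_simps)
  qed
qed

lemma degrees_small_no_F:
  assumes "finite V" "\<And>v r. v \<in> V \<Longrightarrow> card (nbrs V r v) < n"
  shows "\<not> has_F n V"
proof
  assume "has_F n V"
  then obtain r v w where "v \<in> V" "n \<le> card (nbrs V r v - {w})" unfolding has_F_def by blast
  moreover have "card (nbrs V r v - {w}) \<le> card (nbrs V r v)"
    by (intro card_mono finite_nbrs assms(1)) auto
  ultimately show False using assms(2)[of v r] by simp
qed

end

subsection \<open>Graphs and colorings\<close>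

abbreviation (input) pair_color :: "('a set \<Rightarrow> 'b) \<Rightarrow> 'a \<Rightarrow> 'a \<Rightarrow> 'b" where
  "pair_color c \<equiv> \<lambda>x y. c {x, y}"

lemma sym_coloring_pair_color: "sym_coloring (pair_color c)"
  by unfold_locales (simp add: insert_commute)

lemma complete_graph_edge: "{x, y} \<in> edges (complete_graph N) \<longleftrightarrow> x < N \<and> y < N \<and> x \<noteq> y"
  by (auto simp: complete_graph_def nsets_2_eq doubleton_eq_iff)

lemma rainbow_triangle_iff:
  "(\<exists>S. copy_in S (complete_graph 3) (complete_graph N) \<and> rainbow_subgraph c S) \<longleftrightarrow>
    \<not> sym_coloring.gallai (pair_color c) {..<N}" (is "?L \<longleftrightarrow> ?R")
proof
  interpret sym_coloring "pair_color c" by (rule sym_coloring_pair_color)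
  have three: "{..<3} = {0, 1, 2 :: nat}" by auto
  have K3: "edges (complete_graph 3) = {{0, 1}, {0, 2}, {1, 2}}"
    unfolding complete_graph_def snd_conv nsets_2_eq three
    by (simp add: insert_Diff_if) (simp add: insert_commute)
  show ?R if ?L
  proof -
    obtain S f where S: "subgraph S (complete_graph N)" "rainbow_subgraph c S"
      and f: "bij_betw f {..<3} (verts S)" "edges S = (\<lambda>e. f ` e) ` edges (complete_graph 3)"
      using \<open>?L\<close> unfolding copy_in_def isomorphic_def by (auto simp: complete_graph_def)
    have eS: "edges S = {{f 0, f 1}, {f 0, f 2}, {f 1, f 2}}" unfolding f(2) K3 by simp
    have d: "f 0 \<noteq> f 1" "f 0 \<noteq> f 2" "f 1 \<noteq> f 2"
      using f(1) by (simp_all add: bij_betw_def inj_on_def three)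
    have "f 0 \<in> verts S" "f 1 \<in> verts S" "f 2 \<in> verts S"
      using f(1) by (auto simp: bij_betw_def)
    then have V: "f 0 < N" "f 1 < N" "f 2 < N"
      using S(1) by (auto simp: subgraph_def complete_graph_def)
    have "c {f 0, f 1} \<noteq> c {f 0, f 2}" "c {f 0, f 1} \<noteq> c {f 1, f 2}" "c {f 0, f 2} \<noteq> c {f 1, f 2}"
      using S(2) d unfolding rainbow_subgraph_def eS inj_on_def by (auto simp: doubleton_eq_iff)
    then show ?thesis using gallaiD[of "{..<N}" "f 0" "f 1" "f 2"] V d by auto
  qed
  show ?L if ?R
  proof -
    obtain x y z where V: "x < N" "y < N" "z < N" and d: "x \<noteq> y" "y \<noteq> z" "x \<noteq> z"
      and col: "c {x, y} \<noteq> c {x, z}" "c {x, y} \<noteq> c {y, z}" "c {x, z} \<noteq> c {y, z}"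
      using \<open>?R\<close> unfolding gallai_def by auto
    define f where "f i = (if i = 0 then x else if i = 1 then y else z)" for i :: nat
    let ?S = "({x, y, z}, {{x, y}, {x, z}, {y, z}})"
    have "bij_betw f (verts (complete_graph 3)) (verts ?S)"
      using d by (auto simp: complete_graph_def three bij_betw_def f_def)
    moreover have "edges ?S = (\<lambda>e. f ` e) ` edges (complete_graph 3)"
      unfolding K3 by (simp add: f_def insert_commute)
    ultimately have "isomorphic (complete_graph 3) ?S" unfolding isomorphic_def by blast
    moreover have "is_graph ?S" using d by (auto simp: is_graph_def nsets_2_eq)
    then have "subgraph ?S (complete_graph N)"
      using V d complete_graph_edge[of _ _ N] by (auto simp: subgraph_def complete_graph_def)
    moreover have "rainbow_subgraph c ?S" using col by (auto simp: rainbow_subgraph_def)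
    ultimately show ?thesis unfolding copy_in_def by blast
  qed
qed

lemma edges_F2_subset: "2 \<le> n \<Longrightarrow> edges (F2 n) \<subseteq> nsets {..<n + 2} 2"
  by (auto simp: F2_def nsets_def)

text \<open>The center 0 has exactly \<open>n\<close> neighbors 1, 3, 4, ..., \<open>n + 1\<close>,
  and the opposite vertex 2 is not among them. Conversely, two common neighbors become 1 and 3, and
  any \<open>n - 2\<close> further neighbors of the center take the pendant labels.\<close>

lemma mono_F2_iff:
  assumes n: "2 \<le> n"
  shows "(\<exists>S. copy_in S (F2 n) (complete_graph N) \<and> mono_subgraph c S) \<longleftrightarrow>
    sym_coloring.has_F (pair_color c) n {..<N}" (is "?L \<longleftrightarrow> ?R")
proof
  interpret sym_coloring "pair_color c" by (rule sym_coloring_pair_color)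
  show ?R if ?L
  proof -
    obtain S f where S: "subgraph S (complete_graph N)" "mono_subgraph c S"
      and f: "bij_betw f {..<n + 2} (verts S)" "edges S = (\<lambda>e. f ` e) ` edges (F2 n)"
      using \<open>?L\<close> unfolding copy_in_def isomorphic_def by (auto simp: F2_def)
    have inj: "inj_on f {..<n + 2}" using f(1) by (simp add: bij_betw_def)
    have V: "f i < N" if "i < n + 2" for i
      using that f(1) S(1) by (auto simp: subgraph_def complete_graph_def bij_betw_def)
    have e: "{f i, f j} \<in> edges S" if "{i, j} \<in> edges (F2 n)" for i j
      unfolding f(2) using that by (metis image_empty image_eqI image_insert)
    define r where "r = c {f 0, f 1}"
    have r: "c {f i, f j} = r" if "{i, j} \<in> edges (F2 n)" for i j
    proof -
      have "{0, 1} \<in> edges (F2 n)" by (simp add: F2_def)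
      then show ?thesis using e that S(2) unfolding mono_subgraph_def r_def by blast
    qed
    have r0: "c {f 0, f i} = r" if "i \<in> {1, 3} \<union> {4..<n + 2}" for i
      by (rule r) (use that in \<open>auto simp: F2_def insert_commute\<close>)
    have r2: "c {f 2, f i} = r" if "i \<in> {1, 3}" for i
      by (rule r) (use that in \<open>auto simp: F2_def insert_commute\<close>)
    have d: "f i \<noteq> f j" if "i < n + 2" "j < n + 2" "i \<noteq> j" for i j
      using inj that by (auto simp: inj_on_def)
    let ?D = "f ` ({1, 3} \<union> {4..<n + 2})"
    have "card ?D = card ({1, 3} \<union> {4..<n + 2})"
      by (rule card_image, rule inj_on_subset[OF inj]) (use n in auto)
    also have "\<dots> = card {1, 3 :: nat} + card {4..<n + 2}" by (rule card_Un_disjoint) auto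
    finally have D: "n \<le> card ?D" using n by simp
    show ?thesis
    proof (rule has_FI[of "{..<N}" "f 0" "f 2" "{f 1, f 3}" r ?D])
      show "{f 1, f 3} \<subseteq> nbrs {..<N} r (f 0)"
        using r0 V d n by (auto simp: nbrs_def)
      show "{f 1, f 3} \<subseteq> nbrs {..<N} r (f 2)"
        using r2 V d n by (auto simp: nbrs_def)
      show "2 \<le> card {f 1, f 3}" using d[of 1 3] n by simp
      show "?D \<subseteq> nbrs {..<N} r (f 0)"
        using r0 V d n by (auto simp: nbrs_def)
      show "f 2 \<notin> ?D"
      proof
        assume "f 2 \<in> ?D"
        then obtain i where "f 2 = f i" "i \<in> {1, 3} \<union> {4..<n + 2}" by blast
        then show False using d[of 2 i] n by auto
      qed
    qed (use V d[of 0 2] n D in auto)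
  qed
  show ?L if ?R
  proof -
    obtain r v w where v: "v < N" "w < N" "v \<noteq> w"
      and C: "2 \<le> card (nbrs {..<N} r v \<inter> nbrs {..<N} r w)"
      and D: "n \<le> card (nbrs {..<N} r v - {w})"
      using \<open>?R\<close> unfolding has_F_def by auto
    let ?D = "nbrs {..<N} r v - {w}"
    obtain a b where "a \<in> nbrs {..<N} r v \<inter> nbrs {..<N} r w"
      "b \<in> nbrs {..<N} r v \<inter> nbrs {..<N} r w" "a \<noteq> b"
      using C by (rule card_ge_2E)
    then have ab: "a \<in> ?D" "b \<in> ?D" "a \<noteq> b" "c {w, a} = r" "c {w, b} = r"
      by (auto simp: nbrs_def)
    have finD: "finite ?D" by (simp add: finite_nbrs)
    have "n - 2 \<le> card (?D - {a, b})" using D ab finD by (simp add: card_Diff_subset)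
    then obtain X where X: "X \<subseteq> ?D - {a, b}" "card X = n - 2" by (meson obtain_subset_with_card_n)
    have "finite X" using X(1) finD by (meson finite_Diff finite_subset)
    then obtain h where h: "bij_betw h {0..<n - 2} X" using ex_bij_betw_nat_finite X(2) by metis
    have hX: "h (i - 4) \<in> X" if "4 \<le> i" "i < n + 2" for i
      using h that by (auto simp: bij_betw_def)
    have h_inj: "i = j" if "h (i - 4) = h (j - 4)" "4 \<le> i" "4 \<le> j" "i < n + 2" "j < n + 2" for i j
    proof -
      have "i - 4 = j - 4" using h that by (auto simp: bij_betw_def inj_on_def)
      then show ?thesis using that by simp
    qed
    define f where "f i = (if i = 0 then v else if i = 1 then a else if i = 2 then w
      else if i = 3 then b else h (i - 4))" for i :: nat
    have D': "u < N \<and> u \<noteq> v \<and> u \<noteq> w \<and> c {v, u} = r" if "u \<in> ?D" for u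
      using that by (auto simp: nbrs_def)
    have f_simps: "f 0 = v" "f 1 = a" "f 2 = w" "f 3 = b" "f (Suc 0) = a" by (simp_all add: f_def)
    have f4: "f i \<in> ?D - {a, b}" if "4 \<le> i" "i < n + 2" for i
      using hX[OF that] X(1) that unfolding f_def by auto
    have cases_i: "i = 0 \<or> i = 1 \<or> i = 2 \<or> i = 3 \<or> 4 \<le> i" for i :: nat by linarith
    have vwab: "distinct [v, w, a, b]" using D'[OF ab(1)] D'[OF ab(2)] ab(3) v(3) by auto
    have f4': "f i \<notin> {v, w, a, b}" if "4 \<le> i" "i < n + 2" for i
      using D' f4[OF that] by blast
    have neq: "f i \<noteq> f j" if "i < j" "j < n + 2" for i j
    proof (cases "4 \<le> i")
      case True
      then show ?thesis using h_inj[of i j] that unfolding f_def by auto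
    next
      case False
      then show ?thesis
        using cases_i[of i] cases_i[of j] that f4'[of j] f_simps vwab by auto
    qed
    have inj: "inj_on f {..<n + 2}"
      unfolding inj_on_def by (metis lessThan_iff nat_neq_iff neq)
    have fN: "f i < N" if "i < n + 2" for i
      using cases_i[of i] f4[of i] f_simps D'[of "f i"] D'[OF ab(1)] D'[OF ab(2)] v that by auto
    let ?S = "(f ` {..<n + 2}, (\<lambda>e. f ` e) ` edges (F2 n))"
    have iso: "isomorphic (F2 n) ?S"
      unfolding isomorphic_def using inj by (intro exI[of _ f]) (auto simp: F2_def bij_betw_def)
    have edge: "f ` e \<in> nsets (f ` {..<n + 2}) 2" if "e \<in> edges (F2 n)" for e
    proof -
      have e: "e \<subseteq> {..<n + 2}" "finite e" "card e = 2"
        using edges_F2_subset[OF n] that by (auto simp: nsets_def)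
      then have "card (f ` e) = 2" using card_image inj inj_on_subset by metis
      then show ?thesis using e by (auto simp: nsets_def)
    qed
    then have gS: "is_graph ?S" unfolding is_graph_def by auto
    have "f ` {..<n + 2} \<subseteq> {..<N}" using fN by auto
    moreover have "(\<lambda>e. f ` e) ` edges (F2 n) \<subseteq> nsets {..<N} 2"
      using edge nsets_mono[OF \<open>f ` {..<n + 2} \<subseteq> {..<N}\<close>] by blast
    ultimately have "subgraph ?S (complete_graph N)"
      using gS unfolding subgraph_def complete_graph_def by simp
    moreover have "c (f ` e) = r" if "e \<in> edges (F2 n)" for e
    proof -
      from that consider "e = {0, 1}" | "e = {1, 2}" | "e = {2, 3}" | "e = {3, 0}"
        | i where "e = {0, i}" "4 \<le> i" "i < n + 2"
        unfolding F2_def by auto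
      then show ?thesis
        by cases (use ab D' f4 f_simps in \<open>auto simp: insert_commute\<close>)
    qed
    then have "mono_subgraph c ?S" unfolding mono_subgraph_def by auto
    ultimately show ?thesis using iso unfolding copy_in_def by blast
  qed
qed

section \<open>Gallai-Ramsey numbers as minima over avoiding colorings\<close>

text \<open>A symmetric function on pairs, rather than a function on edges, lets extremal colorings
  be given by formulas and restricted to initial segments unchanged.\<close>

definition avoids :: "nat \<Rightarrow> nat \<Rightarrow> nat \<Rightarrow> (nat \<Rightarrow> nat \<Rightarrow> nat) \<Rightarrow> bool" where
  "avoids k n N g \<longleftrightarrow> sym_coloring g \<and> (\<forall>x<N. \<forall>y<N. x \<noteq> y \<longrightarrow> g x y < k) \<and>
     sym_coloring.gallai g {..<N} \<and> \<not> sym_coloring.has_F g n {..<N}"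

lemma avoids_iff:
  assumes "2 \<le> n"
  shows "(\<exists>g. avoids k n N g) \<longleftrightarrow> \<not> (\<forall>c. edge_coloring k (complete_graph N) c \<longrightarrow>
     (\<exists>S. copy_in S (complete_graph 3) (complete_graph N) \<and> rainbow_subgraph c S) \<or>
     (\<exists>S. copy_in S (F2 n) (complete_graph N) \<and> mono_subgraph c S))" (is "?L \<longleftrightarrow> ?R")
proof
  show ?R if ?L
  proof -
    obtain g where g: "avoids k n N g" using \<open>?L\<close> by blast
    \<comment> \<open>With \<open>Min\<close> and \<open>Max\<close>, singletons return the diagonal
      values, so \<open>pair_color c = g\<close> holds as an equality of functions.\<close>
    define c where "c e = g (Min e) (Max e)" for e
    have "g x y = g y x" for x y using g unfolding avoids_def sym_coloring_def by blast
    then have gc: "pair_color c = g"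
      by (intro ext) (simp add: c_def min_def max_def)
    have "edge_coloring k (complete_graph N) c"
      unfolding edge_coloring_def
    proof
      fix e assume e: "e \<in> edges (complete_graph N)"
      then obtain x y where "e = {x, y}" by (auto simp: complete_graph_def nsets_2_eq)
      then show "c e \<in> {..<k}"
        using e complete_graph_edge[of x y N] g gc[THEN fun_cong, THEN fun_cong, of x y]
        unfolding avoids_def by auto
    qed
    then show ?thesis
      using g unfolding rainbow_triangle_iff mono_F2_iff[OF assms] avoids_def
      by (auto simp: gc intro!: exI[of _ c])
  qed
  show ?L if ?R
  proof -
    obtain c where c: "edge_coloring k (complete_graph N) c"
      "sym_coloring.gallai (pair_color c) {..<N}" "\<not> sym_coloring.has_F (pair_color c) n {..<N}"
      using \<open>?R\<close> unfolding rainbow_triangle_iff mono_F2_iff[OF assms] by auto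
    have "avoids k n N (pair_color c)"
      unfolding avoids_def
    proof (intro conjI allI impI)
      fix x y assume "x < N" "y < N" "x \<noteq> y"
      then show "c {x, y} < k"
        using c(1) complete_graph_edge[of x y N] unfolding edge_coloring_def by blast
    qed (use c sym_coloring_pair_color in auto)
    then show ?thesis by blast
  qed
qed

lemma gallai_ramsey_F2:
  assumes "2 \<le> n"
  shows "gallai_ramsey k (complete_graph 3) (F2 n) = (LEAST N. \<not> (\<exists>g. avoids k n N g))"
  unfolding gallai_ramsey_def avoids_iff[OF assms] by simp

lemma two_colors_gallai:
  assumes "sym_coloring g" "\<And>x y. x \<in> V \<Longrightarrow> y \<in> V \<Longrightarrow> x \<noteq> y \<Longrightarrow> g x y < (2 :: nat)"
  shows "sym_coloring.gallai g V"
proof -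
  interpret sym_coloring g by fact
  show ?thesis
    unfolding gallai_def
  proof (intro ballI impI)
    fix x y z assume "x \<in> V" "y \<in> V" "z \<in> V" "x \<noteq> y" "y \<noteq> z" "x \<noteq> z"
    then have "g x y < 2" "g x z < 2" "g y z < 2" using assms(2) by auto
    then show "g x y = g x z \<or> g x y = g y z \<or> g x z = g y z" by linarith
  qed
qed

text \<open>Two colors cannot make a triangle rainbow. So part (1) reduces to one formula for the
  Gallai-Ramsey number, read at \<open>k = 2\<close> as well.\<close>

lemma ramsey_two_F2:
  assumes "2 \<le> n"
  shows "ramsey_two (F2 n) = gallai_ramsey 2 (complete_graph 3) (F2 n)"
proof -
  have "\<nexists>S. copy_in S (complete_graph 3) (complete_graph N) \<and> rainbow_subgraph c S"
    if "edge_coloring 2 (complete_graph N) c" for c N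
  proof -
    have "c {x, y} < 2" if "x < N" "y < N" "x \<noteq> y" for x y
      using \<open>edge_coloring _ _ _\<close> complete_graph_edge[of x y N] that
      unfolding edge_coloring_def by blast
    then have "sym_coloring.gallai (pair_color c) {..<N}"
      by (intro two_colors_gallai[OF sym_coloring_pair_color]) auto
    then show ?thesis unfolding rainbow_triangle_iff by simp
  qed
  then show ?thesis unfolding ramsey_two_def gallai_ramsey_def by (metis (no_types, lifting))
qed

lemma avoids_antimono:
  assumes "avoids k n N g" "N' \<le> N"
  shows "avoids k n N' g"
proof -
  interpret sym_coloring g using assms(1) unfolding avoids_def by blast
  have sub: "{..<N'} \<subseteq> {..<N}" using assms(2) by auto
  show ?thesis
    using assms gallai_subset[OF _ sub] has_F_mono[OF _ sub finite_lessThan]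
    unfolding avoids_def by auto
qed

lemma gallai_ramsey_F2_le:
  assumes "2 \<le> n" "\<And>g. \<not> avoids k n N g"
  shows "gallai_ramsey k (complete_graph 3) (F2 n) \<le> N"
  unfolding gallai_ramsey_F2[OF assms(1)] using assms(2) by (intro Least_le) blast

text \<open>The assumption on \<open>M\<close> guarantees that the minimum is attained; since
  avoiding colorings restrict to fewer vertices, it must lie beyond \<open>N\<close>.\<close>

lemma gallai_ramsey_F2_gt:
  assumes n: "2 \<le> n" and N: "avoids k n N g" and M: "\<And>g. \<not> avoids k n M g"
  shows "N < gallai_ramsey k (complete_graph 3) (F2 n)"
proof -
  let ?L = "LEAST N. \<not> (\<exists>g. avoids k n N g)"
  have "\<not> (\<exists>g. avoids k n ?L g)" by (rule LeastI[of _ M]) (use M in blast)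
  then show ?thesis
    unfolding gallai_ramsey_F2[OF n] using avoids_antimono[OF N] by (meson not_le)
qed

lemma avoids_bound:
  assumes "avoids k n N g" "3 \<le> n"
  shows "n \<le> 4 \<Longrightarrow> N \<le> k + n" "n = 5 \<Longrightarrow> N \<le> k + 8" "3 \<le> k \<Longrightarrow> N \<le> k * (n - 1) + 1"
proof -
  interpret sym_coloring g using assms(1) unfolding avoids_def by blast
  have "gallai {..<N}" "\<not> has_F n {..<N}"
    "\<And>x y. x \<in> {..<N} \<Longrightarrow> y \<in> {..<N} \<Longrightarrow> x \<noteq> y \<Longrightarrow> g x y \<in> {..<k}"
    using assms(1) unfolding avoids_def by auto
  from gallai_F_bound[OF finite_lessThan this(1,2) assms(2) finite_lessThan this(3)]
  show "n \<le> 4 \<Longrightarrow> N \<le> k + n" "n = 5 \<Longrightarrow> N \<le> k + 8" "3 \<le> k \<Longrightarrow> N \<le> k * (n - 1) + 1"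
    by simp_all
qed

subsection \<open>Colorings without large monochromatic stars\<close>

text \<open>If color \<open>p\<close> is a matching, then adding a vertex joined to everything in color \<open>p\<close> creates
  only triangles through that vertex in color \<open>p\<close>, hence no four-cycle.\<close>

lemma avoids_extend:
  assumes av: "avoids k n N g" and n: "2 \<le> n"
    and match: "sym_coloring.matching g p {..<N}" and k': "k \<le> k'" "p < k'"
  shows "avoids k' n (Suc N) (\<lambda>x y. if x = N \<or> y = N then p else g x y)" (is "avoids _ _ _ ?h")
proof -
  interpret g: sym_coloring g using av unfolding avoids_def by blast
  interpret h: sym_coloring ?h by unfold_locales (simp add: g.sym)
  have "h.gallai {..<Suc N}"
    unfolding h.gallai_def
  proof (intro ballI impI)
    fix x y z assume "x \<in> {..<Suc N}" "y \<in> {..<Suc N}" "z \<in> {..<Suc N}" "x \<noteq> y" "y \<noteq> z" "x \<noteq> z"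
    then show "?h x y = ?h x z \<or> ?h x y = ?h y z \<or> ?h x z = ?h y z"
      using g.gallaiD[of "{..<N}" x y z] av unfolding avoids_def by auto
  qed
  moreover have "\<not> h.has_F n {..<Suc N}"
  proof
    assume "h.has_F n {..<Suc N}"
    then obtain r v w where v: "v < Suc N" "w < Suc N" "v \<noteq> w"
      and C: "2 \<le> card (h.nbrs {..<Suc N} r v \<inter> h.nbrs {..<Suc N} r w)"
      and D: "n \<le> card (h.nbrs {..<Suc N} r v - {w})"
      unfolding h.has_F_def by auto
    show False
    proof (cases "r = p")
      case False
      have nb: "h.nbrs {..<Suc N} r u = (if u = N then {} else g.nbrs {..<N} r u)" for u
        using False unfolding h.nbrs_def g.nbrs_def by auto
      have "v \<noteq> N" "w \<noteq> N" using C unfolding nb by auto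
      then have "g.has_F n {..<N}"
        using v C D unfolding nb g.has_F_def by (intro exI[of _ r] bexI[of _ v] bexI[of _ w]) auto
      then show False using av unfolding avoids_def by blast
    next
      case True
      obtain a b where ab: "a \<in> h.nbrs {..<Suc N} r v \<inter> h.nbrs {..<Suc N} r w"
        "b \<in> h.nbrs {..<Suc N} r v \<inter> h.nbrs {..<Suc N} r w" "a \<noteq> b"
        using C by (rule card_ge_2E)
      have no: False if "x < N" "y < N" "z < N" "x \<noteq> y" "x \<noteq> z" "y \<noteq> z" "g x y = p" "g x z = p" for x y z
        using g.not_matchingI[of "{..<N}" x y z p] match that by auto
      have e: "a < Suc N" "b < Suc N" "a \<noteq> v" "a \<noteq> w" "b \<noteq> v" "b \<noteq> w"
        "?h v a = p" "?h v b = p" "?h w a = p" "?h w b = p"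
        using ab True unfolding h.nbrs_def by auto
      \<comment> \<open>The cycle \<open>v, a, w, b\<close> has color \<open>p\<close>. Whichever of
        its vertices is the new one, the vertex opposite to it has two old neighbors in color
        \<open>p\<close>.\<close>
      show False
      proof (cases "v = N")
        case True
        then show False using no[of w a b] e v ab(3) by auto
      next
        case vN: False
        show False
        proof (cases "w = N")
          case True
          then show False using no[of v a b] e v ab(3) vN by auto
        next
          case wN: False
          show False
          proof (cases "a = N")
            case True
            then show False using no[of b v w] e v ab(3) vN wN g.sym by auto
          next
            case False
            then show False using no[of a v w] e v ab(3) vN wN g.sym by auto
          qed
        qed
      qed
    qed
  qed
  moreover have "?h x y < k'" if "x < Suc N" "y < Suc N" "x \<noteq> y" for x y
    using av k' that unfolding avoids_def by (auto simp: less_Suc_eq intro: less_le_trans)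
  ultimately show ?thesis unfolding avoids_def using h.sym_coloring_axioms by blast
qed

text \<open>A color that does not occur yet is trivially a matching, so each new color can dominate
  one new vertex.\<close>

lemma avoids_add_colors:
  assumes "\<exists>g. avoids k n N g" "2 \<le> n"
  shows "\<exists>g. avoids (k + j) n (N + j) g"
proof (induction j)
  case 0
  then show ?case using assms by simp
next
  case (Suc j)
  then obtain g where g: "avoids (k + j) n (N + j) g" by blast
  interpret sym_coloring g using g unfolding avoids_def by blast
  have "nbrs {..<N + j} (k + j) v = {}" if "v < N + j" for v
    using g that unfolding avoids_def nbrs_def by fastforce
  then have "matching (k + j) {..<N + j}" unfolding matching_def by simp
  then show ?case using avoids_extend[OF g assms(2), of "k + j" "k + Suc j"] by auto
qed

lemma card_residue_class:
  assumes "a < d"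
  shows "card {j \<in> {..<d * q}. j mod d = a} = q"
proof -
  have "{j \<in> {..<d * q}. j mod d = a} = (\<lambda>t. d * t + a) ` {..<q}"
  proof (intro equalityI subsetI)
    fix j assume j: "j \<in> {j \<in> {..<d * q}. j mod d = a}"
    then have "j = d * (j div d) + a" using mult_div_mod_eq[of d j] by simp
    moreover have "j div d < q" using j by (auto intro: less_mult_imp_div_less simp: mult.commute)
    ultimately show "j \<in> (\<lambda>t. d * t + a) ` {..<q}" by blast
  next
    fix j assume "j \<in> (\<lambda>t. d * t + a) ` {..<q}"
    then obtain t where t: "j = d * t + a" "t < q" by auto
    have "d * t + d \<le> d * q" using t(2) by (metis Suc_leI mult_Suc_right mult_le_mono2 add.commute)
    then show "j \<in> {j \<in> {..<d * q}. j mod d = a}" using t assms by auto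
  qed
  moreover have "inj_on (\<lambda>t. d * t + a) {..<q}" using assms by (auto simp: inj_on_def)
  ultimately show ?thesis by (simp add: card_image)
qed

text \<open>The blow-up of the two-coloring of \<open>K\<^sub>5\<close> into two five-cycles, whose parts are the residue
  classes modulo 5 and are colored by a third color inside.\<close>

definition pentagon :: "nat \<Rightarrow> nat \<Rightarrow> nat" where
  "pentagon i j = (if i mod 5 = j mod 5 then 2
     else if (i + 1) mod 5 = j mod 5 \<or> (j + 1) mod 5 = i mod 5 then 0 else 1)"

interpretation pentagon: sym_coloring pentagon
  by unfold_locales
    (unfold pentagon_def, rule if_cong[OF eq_commute refl if_cong[OF disj_commute refl refl]])

lemma pentagon_cong:
  assumes "i mod 5 = i' mod 5"
  shows "pentagon i j = pentagon i' j"
proof -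
  have "(i + 1) mod 5 = (i' + 1) mod 5" using assms by (rule mod_add_cong) (rule refl)
  then show ?thesis unfolding pentagon_def using assms by (simp only:)
qed

lemma pentagon_gallai: "pentagon.gallai V"
  unfolding pentagon.gallai_def
proof (intro ballI impI)
  fix x y z :: nat
  have less2: "pentagon i j < 2" if "i mod 5 \<noteq> j mod 5" for i j
    using that by (simp add: pentagon_def)
  consider "x mod 5 = y mod 5" | "x mod 5 = z mod 5" | "y mod 5 = z mod 5"
    | "x mod 5 \<noteq> y mod 5" "x mod 5 \<noteq> z mod 5" "y mod 5 \<noteq> z mod 5" by blast
  then show "pentagon x y = pentagon x z \<or> pentagon x y = pentagon y z \<or> pentagon x z = pentagon y z"
  proof cases
    case 1
    then show ?thesis using pentagon_cong[of x y z] by simp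
  next
    case 2
    then show ?thesis using pentagon_cong[of x z y] pentagon.sym[of y z] by simp
  next
    case 3
    then show ?thesis using pentagon_cong[of y z x] pentagon.sym[of x y] pentagon.sym[of x z] by simp
  next
    case 4
    then show ?thesis using less2[of x y] less2[of x z] less2[of y z] by linarith
  qed
qed

lemma pentagon_residues:
  "pentagon i j = 0 \<Longrightarrow> j mod 5 \<in> {(i mod 5 + 1) mod 5, (i mod 5 + 4) mod 5}"
  "pentagon i j = 1 \<Longrightarrow> j mod 5 \<in> {(i mod 5 + 2) mod 5, (i mod 5 + 3) mod 5}"
  "pentagon i j \<noteq> 0 \<Longrightarrow> pentagon i j \<noteq> 1 \<Longrightarrow> j mod 5 = i mod 5"
proof -
  define a b where ab: "a = i mod 5" "b = j mod 5"
  have P: "pentagon i j = (if a = b then 2 else if (a + 1) mod 5 = b \<or> (b + 1) mod 5 = a then 0 else 1)"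
    unfolding pentagon_def ab by (simp only: mod_add_left_eq)
  have less: "a < 5" "b < 5" unfolding ab by simp_all
  have five: "x = 0 \<or> x = 1 \<or> x = 2 \<or> x = 3 \<or> x = 4" if "x < 5" for x :: nat
    using that by linarith
  show "pentagon i j = 0 \<Longrightarrow> j mod 5 \<in> {(i mod 5 + 1) mod 5, (i mod 5 + 4) mod 5}"
    "pentagon i j = 1 \<Longrightarrow> j mod 5 \<in> {(i mod 5 + 2) mod 5, (i mod 5 + 3) mod 5}"
    "pentagon i j \<noteq> 0 \<Longrightarrow> pentagon i j \<noteq> 1 \<Longrightarrow> j mod 5 = i mod 5"
    unfolding P ab[symmetric] using five[OF less(1)] five[OF less(2)]
    by (elim disjE; simp)+
qed

lemma pentagon_nbrs:
  obtains a b where "a < 5" "b < 5" "a \<noteq> b"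
    "pentagon.nbrs {..<m} r i \<subseteq> {j \<in> {..<m}. j mod 5 = a} \<union> {j \<in> {..<m}. j mod 5 = b}"
proof -
  have shift: "(i mod 5 + s) mod 5 \<noteq> (i mod 5 + t) mod 5" if "s < t" "t < 5" for s t
  proof
    assume "(i mod 5 + s) mod 5 = (i mod 5 + t) mod 5"
    then have "5 dvd (i mod 5 + t) - (i mod 5 + s)" using that by (metis mod_eq_dvd_iff_nat add_le_cancel_left less_imp_le)
    then show False using that by (auto dest: dvd_imp_le)
  qed
  consider "r = 0" | "r = 1" | "r \<noteq> 0" "r \<noteq> 1" by blast
  then show thesis
  proof cases
    case 1
    show thesis
      by (rule that[of "(i mod 5 + 1) mod 5" "(i mod 5 + 4) mod 5"], simp, simp, rule shift)
        (use 1 pentagon_residues(1)[of i] in \<open>simp, simp, unfold pentagon.nbrs_def, blast\<close>)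
  next
    case 2
    show thesis
      by (rule that[of "(i mod 5 + 2) mod 5" "(i mod 5 + 3) mod 5"], simp, simp, rule shift)
        (use 2 pentagon_residues(2)[of i] in \<open>simp, simp, unfold pentagon.nbrs_def, blast\<close>)
  next
    case 3
    \<comment> \<open>The third color stays within one residue class; the second class is only there
      to match the common form.\<close>
    show thesis
      by (rule that[of "(i mod 5 + 0) mod 5" "(i mod 5 + 1) mod 5"], simp, simp, rule shift)
        (use 3 pentagon_residues(3)[of i] in \<open>simp, simp, unfold pentagon.nbrs_def mod_mod_trivial add_0_right, blast\<close>)
  qed
qed

text \<open>A color reaches at most two classes of \<open>q\<close> vertices and the
  \<open>d\<close> surplus vertices, so no vertex can be the center of a copy.\<close>

lemma avoids_pentagon:
  assumes "d \<le> 1" "2 * q + d < n"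
  shows "avoids 3 n (5 * q + d) pentagon"
proof -
  have "card (pentagon.nbrs {..<5 * q + d} r i) < n" for r i
  proof -
    obtain a b where ab: "a < 5" "b < 5" "a \<noteq> b"
      "pentagon.nbrs {..<5 * q + d} r i \<subseteq>
        {j \<in> {..<5 * q + d}. j mod 5 = a} \<union> {j \<in> {..<5 * q + d}. j mod 5 = b}"
      by (rule pentagon_nbrs)
    let ?A = "\<lambda>a. {j \<in> {..<5 * q}. j mod 5 = a}"
    have "pentagon.nbrs {..<5 * q + d} r i \<subseteq> ?A a \<union> ?A b \<union> {5 * q..<5 * q + d}"
      using ab(4) by fastforce
    then have "card (pentagon.nbrs {..<5 * q + d} r i) \<le> card (?A a \<union> ?A b \<union> {5 * q..<5 * q + d})"
      by (intro card_mono) auto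
    also have "\<dots> \<le> card (?A a \<union> ?A b) + card {5 * q..<5 * q + d}" by (rule card_Un_le)
    also have "\<dots> \<le> card (?A a) + card (?A b) + d" using card_Un_le[of "?A a" "?A b"] by simp
    also have "\<dots> = 2 * q + d" using card_residue_class[OF ab(1)] card_residue_class[OF ab(2)] by simp
    finally show ?thesis using assms by linarith
  qed
  then show ?thesis
    unfolding avoids_def
    using pentagon.degrees_small_no_F pentagon_gallai pentagon.sym_coloring_axioms
    by (auto simp: pentagon_def)
qed

text \<open>On five vertices the residue classes are singletons, so the third color does not
  occur.\<close>

lemma avoids_two_colors_3: "avoids 2 3 5 pentagon"
proof -
  have "avoids 3 3 (5 * 1 + 0) pentagon" by (rule avoids_pentagon) auto
  then show ?thesis unfolding avoids_def by (auto simp: pentagon_def)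
qed

text \<open>A complete bipartite graph with sides of three vertices against two disjoint triangles:
  the degrees are 3 and 2.\<close>

lemma avoids_two_colors_4: "avoids 2 4 6 (\<lambda>i j. if i mod 2 = j mod 2 then 0 else 1)"
  (is "avoids _ _ _ ?g")
proof -
  interpret sym_coloring ?g by unfold_locales auto
  have "card (nbrs {..<6} r i) < 4" for r i
  proof -
    have "nbrs {..<6} r i \<subseteq> {j \<in> {..<2 * 3}. j mod 2 = (if r = 0 then i mod 2 else (i + 1) mod 2)}"
      (is "_ \<subseteq> ?A") unfolding nbrs_def by (auto split: if_splits) presburger+
    then have "card (nbrs {..<6} r i) \<le> card ?A" by (intro card_mono) auto
    also have "\<dots> = 3" by (rule card_residue_class) auto
    finally show ?thesis by simp
  qed
  then have "\<not> has_F 4 {..<6}" by (intro degrees_small_no_F) auto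
  moreover have "gallai {..<6}" by (rule two_colors_gallai[OF sym_coloring_axioms]) auto
  ultimately show ?thesis unfolding avoids_def using sym_coloring_axioms by auto
qed

text \<open>The graph \<open>F2 n\<close> has \<open>n + 2\<close> vertices.\<close>

lemma avoids_one_color: "avoids 1 n (n + 1) (\<lambda>_ _. 0)"
proof -
  interpret sym_coloring "\<lambda>_ _ :: nat. 0 :: nat" by unfold_locales auto
  have "\<not> has_F n {..<n + 1}"
  proof
    assume "has_F n {..<n + 1}"
    then obtain r v w where v: "v < n + 1" "w < n + 1" "v \<noteq> w" "n \<le> card (nbrs {..<n + 1} r v - {w})"
      unfolding has_F_def by auto
    have "card (nbrs {..<n + 1} r v - {w}) \<le> card ({..<n + 1} - {v, w})"
      by (rule card_mono) (auto simp: nbrs_def)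
    then show False using v by (simp add: card_Diff_subset)
  qed
  moreover have "gallai {..<n + 1}" unfolding gallai_def by simp
  ultimately show ?thesis unfolding avoids_def using sym_coloring_axioms by auto
qed

text \<open>On ten vertices the residue classes are pairs, so the third color is a matching and can
  be used once more for an eleventh vertex.\<close>

lemma avoids_three_colors_5: "\<exists>g. avoids 3 5 11 g"
proof -
  have av: "avoids 3 5 10 pentagon" using avoids_pentagon[of 0 2 5] by simp
  have "card (pentagon.nbrs {..<10} 2 i) \<le> 1" if i: "i < 10" for i
  proof -
    let ?A = "{j \<in> {..<5 * 2}. j mod 5 = i mod 5}"
    have "pentagon.nbrs {..<10} 2 i \<subseteq> ?A - {i}"
      unfolding pentagon.nbrs_def pentagon_def by (auto split: if_splits)
    then have "card (pentagon.nbrs {..<10} 2 i) \<le> card (?A - {i})" by (intro card_mono) auto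
    also have "\<dots> = 1" using card_residue_class[of "i mod 5" 5 2] i by (simp add: card_Diff_singleton_if)
    finally show ?thesis .
  qed
  then have "pentagon.matching 2 {..<10}" unfolding pentagon.matching_def by auto
  then show ?thesis using avoids_extend[OF av, of 2 3] by auto
qed

section \<open>Exact values and the final bounds\<close>

lemma gallai_ramsey_F2_small:
  assumes "n \<in> {3, 4}" "1 \<le> k"
  shows "gallai_ramsey k (complete_graph 3) (F2 n) = k + n + 1"
proof -
  have n: "2 \<le> n" "3 \<le> n" "n \<le> 4" using assms by auto
  have up: "\<not> avoids k n (k + n + 1) g" for g using avoids_bound(1)[of k n "k + n + 1" g] n by auto
  have "\<exists>g. avoids k n (k + n) g"
  proof (cases "k = 1")
    case True
    then show ?thesis using avoids_one_color[of n] by (auto simp: add.commute)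
  next
    case False
    have "\<exists>g. avoids 2 n (n + 2) g" using assms(1) avoids_two_colors_3 avoids_two_colors_4 by auto
    then have "\<exists>g. avoids (2 + (k - 2)) n (n + 2 + (k - 2)) g" by (rule avoids_add_colors) (rule n)
    moreover have "2 + (k - 2) = k" "n + 2 + (k - 2) = k + n" using False assms(2) by auto
    ultimately show ?thesis by (simp only:)
  qed
  then show ?thesis
    using gallai_ramsey_F2_gt[OF n(1) _ up] gallai_ramsey_F2_le[OF n(1) up] by fastforce
qed

theorem theorem3p2:
  shows "(\<forall>k n::nat. k \<ge> 1 \<and> n \<in> {3, 4} \<longrightarrow>
            int (gallai_ramsey k (complete_graph 3) (F2 n)) = int (ramsey_two (F2 n)) + int k - 2) \<and>
         (\<forall>k::nat. k \<ge> 3 \<longrightarrow> gallai_ramsey k (complete_graph 3) (F2 5) = k + 9) \<and>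
         (\<forall>k n::nat. k \<ge> 3 \<and> n \<ge> 6 \<longrightarrow>
            real k * (real n - 1) + 2 \<ge> real (gallai_ramsey k (complete_graph 3) (F2 n)) \<and>
            real (gallai_ramsey k (complete_graph 3) (F2 n)) \<ge>
              (if even n then 5 * real n / 2 + real k - 6
               else (5 * real n - 1) / 2 + real k - 4))"
proof (intro conjI allI impI)
  fix k n :: nat assume kn: "k \<ge> 1 \<and> n \<in> {3, 4}"
  then have "ramsey_two (F2 n) = 2 + n + 1"
    using ramsey_two_F2[of n] gallai_ramsey_F2_small[of n 2] by auto
  then show "int (gallai_ramsey k (complete_graph 3) (F2 n)) = int (ramsey_two (F2 n)) + int k - 2"
    using gallai_ramsey_F2_small[of n k] kn by simp
next
  fix k :: nat assume k: "k \<ge> 3"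
  have up: "\<not> avoids k 5 (k + 9) g" for g using avoids_bound(2)[of k 5 "k + 9" g] by auto
  have "\<exists>g. avoids (3 + (k - 3)) 5 (11 + (k - 3)) g"
    by (rule avoids_add_colors[OF avoids_three_colors_5]) simp
  moreover have "3 + (k - 3) = k" "11 + (k - 3) = k + 8" using k by auto
  ultimately obtain g where "avoids k 5 (k + 8) g" by (auto simp only:)
  then show "gallai_ramsey k (complete_graph 3) (F2 5) = k + 9"
    using gallai_ramsey_F2_gt[of 5 k "k + 8" g, OF _ _ up] gallai_ramsey_F2_le[of 5, OF _ up]
    by fastforce
next
  fix k n :: nat assume kn: "k \<ge> 3 \<and> n \<ge> 6"
  then have n: "2 \<le> n" "3 \<le> n" and k: "3 \<le> k" by auto
  let ?gr = "gallai_ramsey k (complete_graph 3) (F2 n)"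
  have up: "\<not> avoids k n (k * (n - 1) + 2) g" for g
    using avoids_bound(3)[OF _ n(2) k, of "k * (n - 1) + 2" g] by auto
  have "?gr \<le> k * (n - 1) + 2" by (rule gallai_ramsey_F2_le[OF n(1) up])
  then have "real ?gr \<le> real (k * (n - 1) + 2)" by (rule of_nat_mono)
  then show "real k * (real n - 1) + 2 \<ge> real ?gr" using n by (simp add: of_nat_diff)
  have low: "5 * q + d + (k - 3) < ?gr" if "d \<le> 1" "2 * q + d < n" for q d
  proof -
    have "\<exists>g. avoids (3 + (k - 3)) n (5 * q + d + (k - 3)) g"
      using avoids_pentagon[OF that] by (intro avoids_add_colors n) blast
    moreover have "3 + (k - 3) = k" using k by simp
    ultimately show ?thesis using gallai_ramsey_F2_gt[OF n(1) _ up] by (auto simp only:)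
  qed
  show "real ?gr \<ge> (if even n then 5 * real n / 2 + real k - 6 else (5 * real n - 1) / 2 + real k - 4)"
  proof (cases "even n")
    case True
    then obtain p where "n = 2 * p" by blast
    then have q: "n = 2 * (p - 1) + 2" using n by simp
    define q where "q = p - 1"
    note q = q[folded q_def]
    \<comment> \<open>For even \<open>n\<close>, classes of size \<open>q = (n - 2) / 2\<close>
      leave room for one surplus vertex, as \<open>2 * q + 1 = n - 1\<close>.\<close>
    have "5 * q + 1 + (k - 3) < ?gr" by (rule low) (use q in auto)
    then have "5 * q + k < ?gr + 2" using k by linarith
    then have "5 * real q + real k + 1 \<le> real ?gr + 2" by linarith
    moreover have "real n = 2 * real q + 2" using q by simp
    ultimately have "5 * real n / 2 + real k - 6 \<le> real ?gr" by linarith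
    then show ?thesis by (simp only: True if_True)
  next
    case False
    then obtain q where q: "n = 2 * q + 1" by (rule oddE)
    \<comment> \<open>For odd \<open>n\<close>, classes of size \<open>q = (n - 1) / 2\<close>
      already exhaust the admissible degree \<open>n - 1\<close>.\<close>
    have "5 * q + 0 + (k - 3) < ?gr" by (rule low) (use q in auto)
    then have "5 * q + k < ?gr + 3" using k by linarith
    then have "5 * real q + real k + 1 \<le> real ?gr + 3" by linarith
    moreover have "(5 * real n - 1) / 2 = 5 * real q + 2" using q by simp
    ultimately have "(5 * real n - 1) / 2 + real k - 4 \<le> real ?gr" by linarith
    then show ?thesis by (simp only: False if_False)
  qed
qed

end
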